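(* Let $d>1$, $p\in[1,\infty)$, and let $X_1^*,X_2^*,\ldots$ be mutually independent, identically distributed fuzzy random variables on a probability space $(\Omega,\mathcal F,\mathbf P)$ with values in $(\mathcal F_{\mathrm{cconv}}(\mathbb R^d),d_p)$. Assume that the Bochner expectation $\mathbf E^B X_j^*=m^*$ exists and that the Fréchet variance $\operatorname{Var}^F X_j^*=\sigma^2$ is finite. Let $\alpha\in(0,1]$ and $u\in\mathbb S^{d-1}$, let $\tilde\sigma^2=\operatorname{Var}\, s_{X_j^*}(\alpha,u)$ be the classical variance of the real random variable $s_{X_j^*}(\alpha,u)$ (it does not depend on $j$), and assume $\tilde\sigma>0$. Let $S_0^*=0$ and $S_k^*=X_1^*\oplus\cdots\oplus X_k^*$ for $k\ge1$. For $t\ge 0$ and $n\in\{1,2,\ldots\}$ put $$\tilde s_{M^*_{t,n}}(\alpha,u)=\frac{1}{\tilde\sigma\sqrt n}\Bigl(s_{S^*_{\lfloor nt\rfloor}}(\alpha,u)-\lfloor nt\rfloor\, s_{m^*}(\alpha,u)+(nt-\lfloor nt\rfloor)\,s_{X^*_{\lfloor nt\rfloor+1}}(\alpha,u)-(nt-\lfloor nt\rfloor)\,s_{m^*}(\alpha,u)\Bigr).$$ Let $(b_t)_{t\ge0}$ be a standard Brownian motion in $\mathbb R$. Then for every $k\in\mathbb N$ and all times $0\le t_1<t_2<\cdots<t_k$, $$\bigl(\tilde s_{M^*_{t_1,n}}(\alpha,u),\ldots,\tilde s_{M^*_{t_k,n}}(\alpha,u)\bigr)\longrightarrow (b_{t_1},\ldots,b_{t_k})$$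 in distribution as $n\to\infty$.
   Context: A $d$-dimensional fuzzy vector $x^*$ is identified with its characterizing function $\xi_{x^*}:\mathbb R^d\to[0,1]$. $\mathcal F_{\mathrm{cconv}}(\mathbb R^d)$ is the set of all fuzzy vectors $x^*$ such that $\operatorname{supp}\xi_{x^*}$ is bounded, for every $\alpha\in(0,1]$ the $\alpha$-cut $C_\alpha(x^* )=\{x\in\mathbb R^d:\xi_{x^*}(x)\ge\alpha\}$ is non-empty, compact and convex, and so is $C_0(x^* )=\overline{\{x:\xi_{x^*}(x)>0\}}$. Addition is defined by $C_\alpha(x^*\oplus y^* )=C_\alpha(x^* )+C_\alpha(y^* )$ (Minkowski sum); the fuzzy vector $0$ is the indicator function of the origin. $\mathbb S^{d-1}$ is the Euclidean unit sphere in $\mathbb R^d$ and $\lambda$ is the normalized Lebesgue (surface) measure on it. The support function of $x^*$ is $s_{x^*}(\alpha,u)=\sup_{a\in C_\alpha(x^* )}\langle u,a\rangle$ for $\alpha\in(0,1]$, $u\in\mathbb S^{d-1}$. With $d_H$ the Hausdorff metric (from the Euclidean norm) on non-empty compact convex sets, $d_p(x^*,y^* )=\bigl(\int_0^1 d_H(C_\alpha(x^* ),C_\alpha(y^* ))^p\,d\alpha\bigr)^{1/p}$ for $1\le p<\infty$. A fuzzy random variable is a measurable map from $(\Omega,\mathcal F,\mathbf P)$ to $\mathcal F_{\mathrm{cconv}}(\mathbb R^d)$ with the Borel $\sigma$-field generated by the open $d_p$-balls. For a fuzzy random variable $X^*$ and fixed $(\alpha,u)$, $s_{X^*}(\alpha,u)$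 denotes the real random variable $\omega\mapsto s_{X^*(\omega)}(\alpha,u)$. Independence and identical distribution of fuzzy random variables are with respect to this Borel $\sigma$-field. The Bochner expectation $\mathbf E^BX^*$ is the fuzzy vector in $\mathcal F_{\mathrm{cconv}}(\mathbb R^d)$ determined by $s_{\mathbf E^BX^*}(\alpha,u)=\mathbf E\,s_{X^*}(\alpha,u)$ for all $(\alpha,u)\in(0,1]\times\mathbb S^{d-1}$. The Fréchet variance is $$\operatorname{Var}^FX^*=\mathbf E\int_0^1\int_{\mathbb S^{d-1}}|s_{X^*}(\alpha,u)-s_{\mathbf E^BX^*}(\alpha,u)|^2\,d\lambda(u)\,d\alpha=\int_0^1\int_{\mathbb S^{d-1}}\operatorname{Var} s_{X^*}(\alpha,u)\,d\lambda(u)\,d\alpha.$$ *)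

theory Defs
  imports "HOL-Probability.Probability"
begin

type_synonym 'a fuzzy = "'a \<Rightarrow> real"

definition alpha_cut :: "'a::euclidean_space fuzzy \<Rightarrow> real \<Rightarrow> 'a set" where
  "alpha_cut x \<alpha> = (if \<alpha> = 0 then closure {v. 0 < x v} else {v. \<alpha> \<le> x v})"

definition fcconv :: "'a::euclidean_space fuzzy set" where
  "fcconv = {x. (\<forall>v. 0 \<le> x v \<and> x v \<le> 1) \<and> bounded {v. x v \<noteq> 0} \<and>
     (\<forall>\<alpha>\<in>{0..1}. alpha_cut x \<alpha> \<noteq> {} \<and> compact (alpha_cut x \<alpha>) \<and> convex (alpha_cut x \<alpha>))}"

text \<open>The sum is determined by its \<open>\<alpha>\<close>-cuts; existence and uniqueness on \<^const>\<open>fcconv\<close> are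
  shown in \<open>fuzzy_add_cuts\<close> below. The \<open>+\<close> between sets is the Minkowski sum.\<close>

definition fuzzy_add :: "'a::euclidean_space fuzzy \<Rightarrow> 'a fuzzy \<Rightarrow> 'a fuzzy" where
  "fuzzy_add x y = (THE z. z \<in> fcconv \<and>
     (\<forall>\<alpha>\<in>{0<..1}. alpha_cut z \<alpha> = alpha_cut x \<alpha> + alpha_cut y \<alpha>))"

definition fuzzy_zero :: "'a::euclidean_space fuzzy" where
  "fuzzy_zero = indicator {0}"

definition supp_fun :: "'a::euclidean_space fuzzy \<Rightarrow> real \<Rightarrow> 'a \<Rightarrow> real" where
  "supp_fun x \<alpha> u = (SUP a\<in>alpha_cut x \<alpha>. u \<bullet> a)"

definition hausdorff_dist :: "'a::euclidean_space set \<Rightarrow> 'a set \<Rightarrow> real" where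
  "hausdorff_dist A B = max (SUP a\<in>A. infdist a B) (SUP b\<in>B. infdist b A)"

definition fuzzy_dist :: "real \<Rightarrow> 'a::euclidean_space fuzzy \<Rightarrow> 'a fuzzy \<Rightarrow> real" where
  "fuzzy_dist p x y =
     (LINT \<alpha>:{0..1}|lborel. hausdorff_dist (alpha_cut x \<alpha>) (alpha_cut y \<alpha>) powr p) powr (1 / p)"

definition fuzzy_borel :: "real \<Rightarrow> 'a::euclidean_space fuzzy measure" where
  "fuzzy_borel p = sigma fcconv {{y \<in> fcconv. fuzzy_dist p x y < r} | x r. x \<in> fcconv \<and> 0 < r}"

abbreviation fuzzy_random_variable ::
    "real \<Rightarrow> 'w measure \<Rightarrow> ('w \<Rightarrow> 'a::euclidean_space fuzzy) \<Rightarrow> bool" where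
  "fuzzy_random_variable p M X \<equiv> X \<in> measurable M (fuzzy_borel p)"

text \<open>Normalized surface measure as cone measure: the measure of a subset of the sphere is the
  relative volume of the cone over it in the unit ball. It is realized as a Borel measure on the
  whole space that is concentrated on the unit sphere.\<close>

definition sphere_measure :: "'a::euclidean_space measure" where
  "sphere_measure = distr (uniform_measure lborel (ball 0 1)) borel sgn"

definition has_bochner_expectation ::
    "'w measure \<Rightarrow> ('w \<Rightarrow> 'a::euclidean_space fuzzy) \<Rightarrow> 'a fuzzy \<Rightarrow> bool" where
  "has_bochner_expectation M X m \<longleftrightarrow> m \<in> fcconv \<and>
     (\<forall>\<alpha>\<in>{0<..1}. \<forall>u\<in>sphere 0 1.
        integrable M (\<lambda>\<omega>. supp_fun (X \<omega>) \<alpha> u) \<and>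
        supp_fun m \<alpha> u = (\<integral>\<omega>. supp_fun (X \<omega>) \<alpha> u \<partial>M))"

definition bochner_expectation ::
    "'w measure \<Rightarrow> ('w \<Rightarrow> 'a::euclidean_space fuzzy) \<Rightarrow> 'a fuzzy" where
  "bochner_expectation M X = (THE m. has_bochner_expectation M X m)"

definition frechet_variance :: "'w measure \<Rightarrow> ('w \<Rightarrow> 'a::euclidean_space fuzzy) \<Rightarrow> ennreal" where
  "frechet_variance M X =
     (\<integral>\<^sup>+\<omega>. (\<integral>\<^sup>+\<alpha>\<in>{0<..1}. (\<integral>\<^sup>+u\<in>sphere 0 1.
        ennreal (\<bar>supp_fun (X \<omega>) \<alpha> u - supp_fun (bochner_expectation M X) \<alpha> u\<bar>\<^sup>2)
      \<partial>sphere_measure) \<partial>lborel) \<partial>M)"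

text \<open>The sequence is indexed from \<open>1\<close>; the value \<open>X 0\<close> is never used.\<close>

primrec fuzzy_partial_sum ::
    "(nat \<Rightarrow> 'w \<Rightarrow> 'a::euclidean_space fuzzy) \<Rightarrow> nat \<Rightarrow> 'w \<Rightarrow> 'a fuzzy" where
  "fuzzy_partial_sum X 0 \<omega> = fuzzy_zero"
| "fuzzy_partial_sum X (Suc k) \<omega> = fuzzy_add (fuzzy_partial_sum X k \<omega>) (X (Suc k) \<omega>)"

definition interpolated_supp_fun ::
    "(nat \<Rightarrow> 'w \<Rightarrow> 'a::euclidean_space fuzzy) \<Rightarrow> 'a fuzzy \<Rightarrow> real \<Rightarrow> real \<Rightarrow> 'a \<Rightarrow> nat \<Rightarrow> real \<Rightarrow>
     'w \<Rightarrow> real" where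
  "interpolated_supp_fun X m s \<alpha> u n t \<omega> =
     (let N = nat \<lfloor>real n * t\<rfloor>; r = real n * t - real N in
      1 / (s * sqrt (real n)) *
        (supp_fun (fuzzy_partial_sum X N \<omega>) \<alpha> u - real N * supp_fun m \<alpha> u
          + r * supp_fun (X (N + 1) \<omega>) \<alpha> u - r * supp_fun m \<alpha> u))"

definition standard_brownian_motion :: "'v measure \<Rightarrow> (real \<Rightarrow> 'v \<Rightarrow> real) \<Rightarrow> bool" where
  "standard_brownian_motion N b \<longleftrightarrow> prob_space N \<and>
     (\<forall>t\<ge>0. b t \<in> borel_measurable N) \<and>
     (AE \<omega> in N. b 0 \<omega> = 0) \<and>
     (\<forall>n. \<forall>t :: nat \<Rightarrow> real. 0 \<le> t 0 \<longrightarrow> strict_mono t \<longrightarrow>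
        prob_space.indep_vars N (\<lambda>_. borel) (\<lambda>i \<omega>. b (t (Suc i)) \<omega> - b (t i) \<omega>) {..<n}) \<and>
     (\<forall>s t. 0 \<le> s \<longrightarrow> s < t \<longrightarrow>
        distributed N lborel (\<lambda>\<omega>. b t \<omega> - b s \<omega>) (normal_density 0 (sqrt (t - s)))) \<and>
     (AE \<omega> in N. continuous_on {0..} (\<lambda>t. b t \<omega>))"

definition converges_in_distribution ::
    "'w measure \<Rightarrow> (nat \<Rightarrow> 'w \<Rightarrow> 'b::topological_space) \<Rightarrow> 'v measure \<Rightarrow> ('v \<Rightarrow> 'b) \<Rightarrow> bool" where
  "converges_in_distribution M Y N Z \<longleftrightarrow>
     (\<forall>n. Y n \<in> borel_measurable M) \<and> Z \<in> borel_measurable N \<and>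
     (\<forall>f :: 'b \<Rightarrow> real. continuous_on UNIV f \<longrightarrow> bounded (range f) \<longrightarrow>
        (\<lambda>n. \<integral>\<omega>. f (Y n \<omega>) \<partial>M) \<longlonglongrightarrow> (\<integral>\<omega>. f (Z \<omega>) \<partial>N))"


subsection \<open>Well-definedness\<close>

lemma fcconv_eqI:
  assumes "x \<in> fcconv" "y \<in> fcconv" "\<And>\<alpha>. \<alpha> \<in> {0<..1} \<Longrightarrow> alpha_cut x \<alpha> = alpha_cut y \<alpha>"
  shows "x = y"
proof -
  have le: "x v \<le> y v" if xy: "x \<in> fcconv" "y \<in> fcconv"
    "\<And>\<alpha>. \<alpha> \<in> {0<..1} \<Longrightarrow> alpha_cut x \<alpha> = alpha_cut y \<alpha>" for x y :: "'a fuzzy" and v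
  proof (cases "x v = 0")
    case True
    then show ?thesis using xy(2) by (simp add: fcconv_def)
  next
    case False
    then have "x v \<in> {0<..1}"
      using xy(1) by (simp add: fcconv_def) (metis order_le_less)
    then show ?thesis using xy(3)[of "x v"] by (auto simp: alpha_cut_def)
  qed
  show ?thesis
    using le[of x y] le[of y x] assms by (intro ext order_antisym) auto
qed

lemma fuzzy_add_exists:
  fixes x y :: "'a::euclidean_space fuzzy"
  assumes x: "x \<in> fcconv" and y: "y \<in> fcconv"
  shows "\<exists>z\<in>fcconv. \<forall>\<alpha>\<in>{0<..1}. alpha_cut z \<alpha> = alpha_cut x \<alpha> + alpha_cut y \<alpha>"
proof -
  define A where "A \<alpha> = alpha_cut x \<alpha> + alpha_cut y \<alpha>" for \<alpha>
  define z where "z v = Sup (insert 0 {\<alpha>\<in>{0<..1}. v \<in> A \<alpha>})" for v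
  have bdd: "bdd_above (insert 0 {\<alpha>\<in>{0<..1}. v \<in> A \<alpha>})" for v
    by (rule bdd_aboveI[of _ 1]) auto
  have z0: "0 \<le> z v" for v
    unfolding z_def by (rule cSup_upper[OF _ bdd]) simp
  have z1: "z v \<le> 1" for v
    unfolding z_def by (rule cSup_least) auto
  have mono: "A \<beta> \<subseteq> A \<alpha>" if "0 < \<alpha>" "\<alpha> \<le> \<beta>" for \<alpha> \<beta>
    unfolding A_def by (rule set_plus_mono2) (use that in \<open>auto simp: alpha_cut_def\<close>)
  have cpt: "compact (alpha_cut w \<alpha>)" "convex (alpha_cut w \<alpha>)" "alpha_cut w \<alpha> \<noteq> {}"
    if "\<alpha> \<in> {0..1}" "w \<in> fcconv" for \<alpha> and w :: "'a fuzzy"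
    using that by (auto simp: fcconv_def)
  have below: "v \<in> A \<beta>" if \<beta>z: "0 < \<beta>" "\<beta> < z v" for \<beta> v
  proof -
    obtain \<gamma> where "\<gamma> \<in> insert 0 {\<alpha>\<in>{0<..1}. v \<in> A \<alpha>}" "\<beta> < \<gamma>"
      using \<beta>z(2) unfolding z_def by (subst (asm) less_cSup_iff[OF _ bdd]) auto
    then show ?thesis using mono[of \<beta> \<gamma>] \<beta>z by auto
  qed
  have cutz: "alpha_cut z \<alpha> = A \<alpha>" if \<alpha>: "\<alpha> \<in> {0<..1}" for \<alpha>
  proof (intro set_eqI iffI)
    fix v assume "v \<in> A \<alpha>"
    then have "\<alpha> \<le> z v" unfolding z_def using \<alpha> by (intro cSup_upper[OF _ bdd]) auto
    then show "v \<in> alpha_cut z \<alpha>" using \<alpha> by (auto simp: alpha_cut_def)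
  next
    fix v assume "v \<in> alpha_cut z \<alpha>"
    then have v: "\<alpha> \<le> z v" using \<alpha> by (auto simp: alpha_cut_def)
    define \<beta> where "\<beta> n = \<alpha> * (1 - 1 / (real n + 2))" for n :: nat
    have \<beta>: "0 < \<beta> n" "\<beta> n < \<alpha>" "\<beta> n \<in> {0..1}" for n
    proof -
      have "0 < 1 - 1 / (real n + 2)" by simp
      moreover have "1 - 1 / (real n + 2) < 1" by simp
      ultimately show 1: "0 < \<beta> n" "\<beta> n < \<alpha>"
        using \<alpha> mult_strict_left_mono[of "1 - 1 / (real n + 2)" 1 \<alpha>]
        unfolding \<beta>_def by (auto intro: mult_pos_pos)
      show "\<beta> n \<in> {0..1}" using 1 \<alpha> by auto
    qed
    have \<beta>mono: "\<beta> m \<le> \<beta> n" if "m \<le> n" for m n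
      unfolding \<beta>_def using \<alpha> that by (intro mult_left_mono) (auto simp: frac_le)
    have "(\<lambda>n. 1 / (real n + 2)) = (\<lambda>n. inverse (real (Suc (Suc n))))"
      by (simp add: field_simps)
    then have "(\<lambda>n. 1 / (real n + 2)) \<longlonglongrightarrow> 0"
      using LIMSEQ_Suc[OF LIMSEQ_inverse_real_of_nat] by simp
    from tendsto_mult[OF tendsto_const tendsto_diff[OF tendsto_const this]]
    have "\<beta> \<longlonglongrightarrow> \<alpha> * (1 - 0)"
      unfolding \<beta>_def .
    then have lim: "\<beta> \<longlonglongrightarrow> \<alpha>" by simp
    define K where "K n = alpha_cut x (\<beta> n) \<inter> (\<lambda>b. v - b) ` alpha_cut y (\<beta> n)" for n
    have "(\<Inter>n. K n) \<noteq> {}"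
    proof (rule compact_nest)
      fix n
      show "compact (K n)"
        unfolding K_def using cpt(1)[OF \<beta>(3) x] cpt(1)[OF \<beta>(3) y]
        by (intro compact_Int compact_continuous_image continuous_intros)
      have "v \<in> A (\<beta> n)" using below \<beta>[of n] v by auto
      then obtain a b where "v = a + b" "a \<in> alpha_cut x (\<beta> n)" "b \<in> alpha_cut y (\<beta> n)"
        by (auto simp: A_def set_plus_def)
      then have "a \<in> K n" by (auto simp: K_def image_iff intro!: bexI[of _ b])
      then show "K n \<noteq> {}" by auto
    next
      fix m n :: nat assume "m \<le> n"
      from \<beta>mono[OF this] \<beta>(1)[of m] \<beta>(1)[of n] show "K n \<subseteq> K m"
        by (auto simp: K_def alpha_cut_def)
    qed
    then obtain a where a: "\<And>n. a \<in> K n" by auto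
    have "\<beta> n \<le> x a" "\<beta> n \<le> y (v - a)" for n
      using a[of n] \<beta>(1)[of n] by (auto simp: K_def alpha_cut_def)
    then have "\<alpha> \<le> x a" "\<alpha> \<le> y (v - a)"
      using lim by (auto intro: LIMSEQ_le_const2)
    then have "a \<in> alpha_cut x \<alpha>" "v - a \<in> alpha_cut y \<alpha>"
      using \<alpha> by (auto simp: alpha_cut_def)
    from set_plus_intro[OF this] show "v \<in> A \<alpha>" by (simp add: A_def)
  qed
  have supp_sub: "{v. z v \<noteq> 0} \<subseteq> {v. x v \<noteq> 0} + {v. y v \<noteq> 0}"
  proof
    fix v assume "v \<in> {v. z v \<noteq> 0}"
    then have "0 < z v" using z0[of v] by auto
    then have "v \<in> A (z v / 2)" by (intro below) auto
    then show "v \<in> {v. x v \<noteq> 0} + {v. y v \<noteq> 0}"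
      using \<open>0 < z v\<close> by (force simp: A_def alpha_cut_def set_plus_def)
  qed
  have "bounded ({v. x v \<noteq> 0} + {v. y v \<noteq> 0})"
  proof -
    have "bounded {a + b |a b. a \<in> {v. x v \<noteq> 0} \<and> b \<in> {v. y v \<noteq> 0}}"
    proof -
      obtain B where B: "\<And>v. x v \<noteq> 0 \<Longrightarrow> norm v \<le> B"
        using x by (auto simp: fcconv_def bounded_iff)
      obtain C where C: "\<And>v. y v \<noteq> 0 \<Longrightarrow> norm v \<le> C"
        using y by (auto simp: fcconv_def bounded_iff)
      show ?thesis
        unfolding bounded_iff by (rule exI[of _ "B + C"]) (auto intro!: norm_triangle_mono B C)
    qed
    moreover have "{v. x v \<noteq> 0} + {v. y v \<noteq> 0} =
        {a + b |a b. a \<in> {v. x v \<noteq> 0} \<and> b \<in> {v. y v \<noteq> 0}}"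
      by (auto simp: set_plus_def)
    ultimately show ?thesis by simp
  qed
  then have bz: "bounded {v. z v \<noteq> 0}" using supp_sub by (rule bounded_subset)
  then have bz': "bounded {v. 0 < z v}" by (rule bounded_subset) auto
  have "convex {v. 0 < z v}"
  proof (rule convexI)
    fix a b and s t :: real
    assume ab: "a \<in> {v. 0 < z v}" "b \<in> {v. 0 < z v}" and st: "0 \<le> s" "0 \<le> t" "s + t = 1"
    define \<gamma> where "\<gamma> = min (z a) (z b)"
    have \<gamma>: "\<gamma> \<in> {0<..1}" using ab z1[of a] by (auto simp: \<gamma>_def)
    have "convex (alpha_cut z \<gamma>)"
      unfolding cutz[OF \<gamma>] A_def using \<gamma> x y by (intro convex_set_plus cpt) auto
    moreover have "a \<in> alpha_cut z \<gamma>" "b \<in> alpha_cut z \<gamma>"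
      using \<gamma> by (auto simp: alpha_cut_def \<gamma>_def)
    ultimately have "s *\<^sub>R a + t *\<^sub>R b \<in> alpha_cut z \<gamma>" using st by (auto simp: convex_def)
    then show "s *\<^sub>R a + t *\<^sub>R b \<in> {v. 0 < z v}" using \<gamma> by (auto simp: alpha_cut_def)
  qed
  have cut_pos: "alpha_cut z \<alpha> \<noteq> {} \<and> compact (alpha_cut z \<alpha>) \<and> convex (alpha_cut z \<alpha>)"
    if \<alpha>: "\<alpha> \<in> {0<..1}" for \<alpha>
  proof -
    have *: "\<alpha> \<in> {0..1}" using \<alpha> by auto
    have "alpha_cut z \<alpha> = {a + b |a b. a \<in> alpha_cut x \<alpha> \<and> b \<in> alpha_cut y \<alpha>}"
      unfolding cutz[OF \<alpha>] A_def by (auto simp: set_plus_def)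
    then have "compact (alpha_cut z \<alpha>)"
      using compact_sums[OF cpt(1)[OF * x] cpt(1)[OF * y]] by simp
    moreover have "convex (alpha_cut z \<alpha>)"
      unfolding cutz[OF \<alpha>] A_def by (intro convex_set_plus cpt[OF * x] cpt[OF * y])
    moreover have "alpha_cut z \<alpha> \<noteq> {}"
      unfolding cutz[OF \<alpha>] A_def using cpt(3)[OF * x] cpt(3)[OF * y]
      by (auto simp: set_plus_def)
    ultimately show ?thesis by blast
  qed
  have "alpha_cut z 1 \<subseteq> {v. 0 < z v}" by (auto simp: alpha_cut_def)
  then have ne: "{v. 0 < z v} \<noteq> {}" using cut_pos[of 1] by auto
  have "alpha_cut z \<alpha> \<noteq> {} \<and> compact (alpha_cut z \<alpha>) \<and> convex (alpha_cut z \<alpha>)"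
    if "\<alpha> \<in> {0..1}" for \<alpha>
  proof (cases "\<alpha> = 0")
    case True
    then show ?thesis
      using ne bz' \<open>convex {v. 0 < z v}\<close> by (auto simp: alpha_cut_def convex_closure)
  next
    case False
    then show ?thesis using that by (intro cut_pos) auto
  qed
  then have "z \<in> fcconv" using z0 z1 bz by (auto simp: fcconv_def)
  then show ?thesis using cutz unfolding A_def by blast
qed

lemma fuzzy_add_cuts:
  assumes "x \<in> fcconv" "y \<in> fcconv"
  shows "fuzzy_add x y \<in> fcconv"
    and "\<alpha> \<in> {0<..1} \<Longrightarrow> alpha_cut (fuzzy_add x y) \<alpha> = alpha_cut x \<alpha> + alpha_cut y \<alpha>"
proof -
  have "\<exists>!z. z \<in> fcconv \<and> (\<forall>\<alpha>\<in>{0<..1}. alpha_cut z \<alpha> = alpha_cut x \<alpha> + alpha_cut y \<alpha>)"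
    using fuzzy_add_exists[OF assms] by (auto intro: fcconv_eqI)
  from theI'[OF this] show "fuzzy_add x y \<in> fcconv"
    and "\<alpha> \<in> {0<..1} \<Longrightarrow> alpha_cut (fuzzy_add x y) \<alpha> = alpha_cut x \<alpha> + alpha_cut y \<alpha>"
    by (auto simp: fuzzy_add_def)
qed

lemma supp_fun_eq_imp_cut_subset:
  fixes x y :: "'a::euclidean_space fuzzy"
  assumes x: "x \<in> fcconv" and y: "y \<in> fcconv" and \<alpha>: "\<alpha> \<in> {0<..1}"
    and eq: "\<And>u. u \<in> sphere 0 1 \<Longrightarrow> supp_fun x \<alpha> u = supp_fun y \<alpha> u"
  shows "alpha_cut x \<alpha> \<subseteq> alpha_cut y \<alpha>"
proof
  fix v assume v: "v \<in> alpha_cut x \<alpha>"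
  show "v \<in> alpha_cut y \<alpha>"
  proof (rule ccontr)
    assume nv: "v \<notin> alpha_cut y \<alpha>"
    have X: "compact (alpha_cut x \<alpha>)" and Y: "compact (alpha_cut y \<alpha>)" "convex (alpha_cut y \<alpha>)"
      "alpha_cut y \<alpha> \<noteq> {}"
      using x y \<alpha> by (auto simp: fcconv_def)
    obtain a b where ab: "a \<bullet> v < b" "\<And>w. w \<in> alpha_cut y \<alpha> \<Longrightarrow> b < a \<bullet> w"
      using separating_hyperplane_closed_point[OF Y(2) compact_imp_closed[OF Y(1)] nv] by blast
    have "a \<noteq> 0" using ab Y(3) by force
    define u where "u = - (a /\<^sub>R norm a)"
    have u: "u \<in> sphere 0 1" using \<open>a \<noteq> 0\<close> by (simp add: u_def)
    have "supp_fun y \<alpha> u \<le> - b / norm a"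
      unfolding supp_fun_def using Y(3)
    proof (rule cSUP_least)
      fix w assume "w \<in> alpha_cut y \<alpha>"
      from ab(2)[OF this] show "u \<bullet> w \<le> - b / norm a"
        using \<open>a \<noteq> 0\<close> by (simp add: u_def divide_simps)
    qed
    also have "\<dots> < u \<bullet> v" using ab(1) \<open>a \<noteq> 0\<close> by (simp add: u_def divide_simps)
    also have "u \<bullet> v \<le> supp_fun x \<alpha> u"
      unfolding supp_fun_def
    proof (rule cSUP_upper[OF v])
      have "compact ((\<lambda>w. u \<bullet> w) ` alpha_cut x \<alpha>)"
        using X by (intro compact_continuous_image continuous_intros)
      then show "bdd_above ((\<lambda>w. u \<bullet> w) ` alpha_cut x \<alpha>)"
        by (intro bounded_imp_bdd_above compact_imp_bounded)
    qed
    finally show False using eq[OF u] by simp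
  qed
qed

lemma bochner_expectation_eqI:
  assumes "has_bochner_expectation M X m"
  shows "bochner_expectation M X = m"
  unfolding bochner_expectation_def
proof (rule the_equality)
  show "has_bochner_expectation M X m" by (fact assms)
next
  fix m' assume m': "has_bochner_expectation M X m'"
  have F: "m \<in> fcconv" "m' \<in> fcconv"
    using assms m' by (auto simp: has_bochner_expectation_def)
  have "supp_fun m \<alpha> u = supp_fun m' \<alpha> u" if "\<alpha> \<in> {0<..1}" "u \<in> sphere 0 1" for \<alpha> u
    using assms m' that by (simp add: has_bochner_expectation_def)
  then show "m' = m"
    using F by (intro fcconv_eqI equalityI supp_fun_eq_imp_cut_subset) auto
qed

lemma emeasure_unit_ball: "emeasure lborel (ball (0::'a::euclidean_space) 1) \<noteq> 0"
    "emeasure lborel (ball (0::'a) 1) \<noteq> \<infinity>"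
proof -
  have "0 < measure lborel (ball (0::'a) 1)" using content_ball_pos[of 1 "0::'a"] by simp
  then show "emeasure lborel (ball (0::'a) 1) \<noteq> 0" by (auto simp: measure_def)
  show "emeasure lborel (ball (0::'a) 1) \<noteq> \<infinity>"
    using emeasure_lborel_ball_finite[of "0::'a" 1] by simp
qed

lemma prob_space_sphere_measure: "prob_space (sphere_measure :: 'a::euclidean_space measure)"
proof -
  interpret prob_space "uniform_measure lborel (ball (0::'a) 1)"
    using emeasure_unit_ball by (rule prob_space_uniform_measure)
  show ?thesis unfolding sphere_measure_def by (rule prob_space_distr) simp
qed

lemma AE_sphere_measure: "AE u in sphere_measure. u \<in> sphere (0::'a::euclidean_space) 1"
proof -
  have "AE v in lborel. v \<noteq> (0::'a)" by (rule AE_lborel_singleton)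
  then have "AE v in uniform_measure lborel (ball 0 1). sgn v \<in> sphere (0::'a) 1"
    by (intro AE_uniform_measureI) (auto simp: norm_sgn)
  then show ?thesis
    unfolding sphere_measure_def by (subst AE_distr_iff) auto
qed

end

theory Submission
  imports Defs
begin

text \<open>
  For a fixed level and direction, the support function turns the fuzzy sum into a sum of real
  random variables: \<open>supp_fun\<close> is additive (\<open>supp_fun_fuzzy_partial_sum\<close>), so the claim is the
  finite-dimensional part of Donsker's theorem for the centred variables
  \<open>Y k = supp_fun (X k) \<alpha> u - supp_fun m \<alpha> u\<close>. Two points need an argument.

  First, independence and equality in law are given for the fuzzy variables with respect to the
  \<open>\<sigma>\<close>-field generated by the \<open>d\<^sub>p\<close>-balls. They pass to the \<open>Y k\<close> because \<open>x \<mapsto> supp_fun x \<alpha> u\<close> is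
  measurable for that \<open>\<sigma>\<close>-field (\<open>supp_fun_measurable\<close>). Distances to fixed fuzzy vectors are
  measurable by definition, and, as for Busemann functions, the distance to a point \<open>- R u\<close> is
  \<open>R\<close> plus the support function in direction \<open>u\<close> up to an error \<open>O(1/R)\<close>. Two-step fuzzy vectors with a
  jump at level \<open>\<beta>\<close> thus give the integral of the support function over \<open>(\<beta>, 1]\<close> minus its
  integral over \<open>(0, \<beta>]\<close>. Subtracting two such integrals leaves averages over short intervals of
  levels, and left-continuity in the level recovers the value at \<open>\<alpha>\<close>.

  Second, the central limit theorem has to be made joint in several times. The walk is cut into
  disjoint blocks of indices: one block for each gap between consecutive times, and a block of length
  one for each summand that is interpolated. Block sums are independent, and the law of each depends on
  its length only. So a Skorohod representation of the one-dimensional central limit theorem, taken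
  independently for each block on a product space, yields variables with the same joint law that
  converge pointwise (\<open>iid_block_sums_coupling\<close>). The interpolated walk at the given times is a linear
  function of the block sums; hence it converges pointwise on the product space, bounded continuous
  functions of it converge in mean by dominated convergence, and the blocks of length one vanish in
  the limit without any separate tightness or Slutsky argument. The limit is a vector of partial
  sums of independent centred Gaussian variables with the variances of the Brownian increments
  (\<open>brownian_increments_law\<close>).
\<close>

section \<open>Hausdorff distance to remote points and segments\<close>

text \<open>Near the origin, a sphere around the far point \<open>R u\<close> is nearly a hyperplane orthogonal to \<open>u\<close>.\<close>

lemma norm_diff_remote_bounds:
  fixes a u :: "'a::euclidean_space"
  assumes u: "norm u = 1" and a: "norm a \<le> B" and R: "2 * B \<le> R" "0 < R"
  shows "R - u \<bullet> a \<le> norm (R *\<^sub>R u - a)" "norm (R *\<^sub>R u - a) \<le> R - u \<bullet> a + B\<^sup>2 / R"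
proof -
  have uu: "u \<bullet> u = 1" using u by (simp add: dot_square_norm)
  have "R - u \<bullet> a = u \<bullet> (R *\<^sub>R u - a)" by (simp add: inner_diff_right uu)
  also have "\<dots> \<le> norm (R *\<^sub>R u - a)" using norm_cauchy_schwarz[of u "R *\<^sub>R u - a"] u by simp
  finally show "R - u \<bullet> a \<le> norm (R *\<^sub>R u - a)" .
  have "u \<bullet> a \<le> B" using norm_cauchy_schwarz[of u a] u a by simp
  then have half: "R / 2 \<le> R - u \<bullet> a" using R by simp
  have B: "0 \<le> B" using a norm_ge_zero[of a] by linarith
  have "(norm (R *\<^sub>R u - a))\<^sup>2 = R\<^sup>2 - 2 * R * (u \<bullet> a) + (norm a)\<^sup>2"
    unfolding power2_norm_eq_inner
    by (simp add: inner_diff uu inner_commute[of a u] power2_eq_square algebra_simps)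
  also have "\<dots> \<le> R\<^sup>2 - 2 * R * (u \<bullet> a) + B\<^sup>2" using a by (simp add: power_mono)
  also have "\<dots> \<le> (R - u \<bullet> a)\<^sup>2 + 2 * (R / 2) * (B\<^sup>2 / R)"
    using R by (simp add: power2_diff)
  also have "\<dots> \<le> (R - u \<bullet> a)\<^sup>2 + 2 * (R - u \<bullet> a) * (B\<^sup>2 / R)"
    by (intro add_left_mono mult_right_mono) (use half R in auto)
  also have "\<dots> \<le> (R - u \<bullet> a + B\<^sup>2 / R)\<^sup>2" by (simp add: power2_sum)
  finally show "norm (R *\<^sub>R u - a) \<le> R - u \<bullet> a + B\<^sup>2 / R"
    by (rule power2_le_imp_le) (use half R B in auto)
qed

lemma bdd_above_inner:
  assumes "compact A"
  shows "bdd_above ((\<lambda>a. u \<bullet> (a::'a::euclidean_space)) ` A)"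
  by (intro bounded_imp_bdd_above compact_imp_bounded compact_continuous_image continuous_intros assms)

lemma bdd_above_infdist:
  fixes A B :: "'a::euclidean_space set"
  assumes "compact A"
  shows "bdd_above ((\<lambda>a. infdist a B) ` A)"
  by (intro bounded_imp_bdd_above compact_imp_bounded compact_continuous_image continuous_intros assms)

lemma abs_SUP_inner_le:
  fixes A :: "'a::euclidean_space set"
  assumes "A \<noteq> {}" "A \<subseteq> cball 0 B" "norm u = 1"
  shows "\<bar>SUP a\<in>A. u \<bullet> a\<bar> \<le> B"
proof -
  have *: "\<bar>u \<bullet> a\<bar> \<le> B" if "a \<in> A" for a
    using Cauchy_Schwarz_ineq2[of u a] assms(2,3) that by auto
  obtain a where a: "a \<in> A" using assms by auto
  have "(SUP a\<in>A. u \<bullet> a) \<le> B" using * assms(1) by (intro cSUP_least) (auto simp: abs_le_iff)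
  moreover have "u \<bullet> a \<le> (SUP a\<in>A. u \<bullet> a)"
    by (intro cSUP_upper a bdd_aboveI2[of _ _ B]) (use * in \<open>auto simp: abs_le_iff\<close>)
  ultimately show ?thesis using *[OF a] by linarith
qed

text \<open>The Hausdorff distance to a single point is attained by the point of \<open>A\<close> farthest from it, which
  for a remote point \<open>- R u\<close> is nearly the point of \<open>A\<close> extremal in direction \<open>u\<close>.\<close>

lemma hausdorff_dist_remote_point:
  fixes A :: "'a::euclidean_space set"
  assumes A: "compact A" "A \<noteq> {}" "A \<subseteq> cball 0 B" and u: "norm u = 1" and R: "2 * B \<le> R" "0 < R"
  shows "\<bar>hausdorff_dist {- R *\<^sub>R u} A - (R + (SUP a\<in>A. u \<bullet> a))\<bar> \<le> B\<^sup>2 / R"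
proof -
  let ?w = "- R *\<^sub>R u" and ?s = "SUP a\<in>A. u \<bullet> a"
  have d: "infdist a {?w} = norm (R *\<^sub>R (- u) - a)" for a
    by (simp add: dist_norm norm_minus_commute)
  have lo: "R + u \<bullet> a \<le> infdist a {?w}" and hi: "infdist a {?w} \<le> R + u \<bullet> a + B\<^sup>2 / R"
    if "a \<in> A" for a
    using norm_diff_remote_bounds[of "- u" a B R] u A(3) that R unfolding d by auto
  have up: "infdist a {?w} \<le> R + ?s + B\<^sup>2 / R" if "a \<in> A" for a
    using hi[OF that] cSUP_upper[OF that bdd_above_inner[OF A(1), of u]] by linarith
  obtain a where a: "a \<in> A" using A by auto
  have "infdist ?w A \<le> infdist a {?w}"
    using infdist_le[OF a, of ?w] by (simp add: dist_commute)
  then have 1: "hausdorff_dist {?w} A \<le> R + ?s + B\<^sup>2 / R"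
    unfolding hausdorff_dist_def using up a by (auto intro!: cSUP_least intro: order_trans)
  have "?s \<le> hausdorff_dist {?w} A - R"
  proof (rule cSUP_least[OF A(2)])
    fix a assume a: "a \<in> A"
    have "infdist a {?w} \<le> (SUP a\<in>A. infdist a {?w})"
      by (intro cSUP_upper a bdd_above_infdist A)
    then show "u \<bullet> a \<le> hausdorff_dist {?w} A - R"
      using lo[OF a] unfolding hausdorff_dist_def by linarith
  qed
  moreover have "0 \<le> B\<^sup>2 / R" using R by simp
  ultimately show ?thesis using 1 by linarith
qed

text \<open>The segment reaches farther in direction \<open>u\<close> than in direction \<open>- u\<close>. If the excess \<open>c\<close> is at
  least twice the radius of \<open>A\<close>, the far end \<open>(R + c) u\<close> is the point of the segment farthest from \<open>A\<close>. The
  support function in direction \<open>u\<close> then enters with a minus sign, whereas for the point \<open>- R u\<close> it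
  enters with a plus sign. An end at \<open>- R u\<close> is kept so that the point is contained in the segment,
  as nested level sets require.\<close>

lemma hausdorff_dist_remote_segment:
  fixes A :: "'a::euclidean_space set"
  assumes A: "compact A" "A \<noteq> {}" "A \<subseteq> cball 0 B" and u: "norm u = 1" and R: "2 * B \<le> R" "0 < R"
    and c: "2 * B \<le> c"
  shows "\<bar>hausdorff_dist (closed_segment (- R *\<^sub>R u) ((R + c) *\<^sub>R u)) A
           - (R + (c - (SUP a\<in>A. u \<bullet> a)))\<bar> \<le> B\<^sup>2 / R"
proof -
  let ?G = "closed_segment (- R *\<^sub>R u) ((R + c) *\<^sub>R u)" and ?s = "SUP a\<in>A. u \<bullet> a"
  have B: "0 \<le> B" using A(2,3) norm_ge_zero order_trans by fastforce
  have s: "\<bar>?s\<bar> \<le> B" by (rule abs_SUP_inner_le[OF A(2,3) u])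
  have q: "0 \<le> B\<^sup>2 / R" using R by simp
  obtain a' where a': "a' \<in> A" "u \<bullet> a' = ?s"
  proof -
    obtain a' where 1: "a' \<in> A" "\<And>a. a \<in> A \<Longrightarrow> u \<bullet> a \<le> u \<bullet> a'"
      using continuous_attains_sup[OF A(1,2) continuous_on_inner[OF continuous_on_const continuous_on_id], of u]
      by auto
    have "?s \<le> u \<bullet> a'" using 1 A(2) by (intro cSUP_least)
    moreover have "u \<bullet> a' \<le> ?s" by (intro cSUP_upper 1 bdd_above_inner A)
    ultimately show ?thesis using that 1 by auto
  qed
  have G0: "0 \<in> ?G"
  proof -
    \<comment> \<open>The parameter at which the segment passes through the origin.\<close>
    define v where "v = R / (R + (R + c))"
    have "0 \<le> v" "v \<le> 1" "(1 - v) * (- R) + v * (R + c) = 0"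
      using R c B by (auto simp: v_def divide_simps)
    moreover have "(1 - v) *\<^sub>R (- R *\<^sub>R u) + v *\<^sub>R ((R + c) *\<^sub>R u)
        = ((1 - v) * (- R) + v * (R + c)) *\<^sub>R u"
      by (simp only: scaleR_scaleR) (simp only: scaleR_add_left)
    ultimately show ?thesis unfolding in_segment by (intro exI[of _ v]) simp
  qed
  have seg: "\<exists>l. b = l *\<^sub>R u \<and> - R \<le> l \<and> l \<le> R + c" if b: "b \<in> ?G" for b
  proof -
    obtain v where v: "0 \<le> v" "v \<le> 1" "b = (1 - v) *\<^sub>R (- R *\<^sub>R u) + v *\<^sub>R ((R + c) *\<^sub>R u)"
      using b by (auto simp: in_segment)
    have "b = ((1 - v) * (- R) + v * (R + c)) *\<^sub>R u"
      unfolding v(3) by (simp only: scaleR_scaleR) (simp only: scaleR_add_left)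
    moreover have "- R \<le> (1 - v) * (- R) + v * (R + c)" "(1 - v) * (- R) + v * (R + c) \<le> R + c"
    proof -
      have "(1 - v) * (- R) + v * (R + c) = - R + v * (R + (R + c))" by (simp add: algebra_simps)
      moreover have "0 \<le> v * (R + (R + c))" using v R c B by (intro mult_nonneg_nonneg) auto
      moreover have "v * (R + (R + c)) \<le> R + (R + c)"
        using v R c B by (intro mult_left_le_one_le) auto
      ultimately show "- R \<le> (1 - v) * (- R) + v * (R + c)" "(1 - v) * (- R) + v * (R + c) \<le> R + c"
        by linarith+
    qed
    ultimately show ?thesis by blast
  qed
  have 1: "infdist a ?G \<le> R + (c - ?s) + B\<^sup>2 / R" if "a \<in> A" for a
  proof -
    have "infdist a ?G \<le> norm a" using infdist_le[OF G0, of a] by simp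
    also have "\<dots> \<le> B" using A(3) that by auto
    finally show ?thesis using s c R q by linarith
  qed
  have 2: "infdist b A \<le> R + (c - ?s) + B\<^sup>2 / R" if b: "b \<in> ?G" for b
  proof -
    obtain l where l: "b = l *\<^sub>R u" "- R \<le> l" "l \<le> R + c" using seg[OF b] by blast
    have i: "infdist b A \<le> norm (l *\<^sub>R u - a')"
      using infdist_le[OF a'(1), of b] by (simp add: l dist_norm)
    have na: "norm a' \<le> B" using a' A(3) by auto
    show ?thesis
    proof (cases "l \<le> R")
      case True
      have "norm (l *\<^sub>R u - a') \<le> \<bar>l\<bar> + B"
        using norm_triangle_ineq4[of "l *\<^sub>R u" a'] na u by simp
      then show ?thesis using i True l s c q by linarith
    next
      case False
      have "norm (l *\<^sub>R u - a') \<le> l - u \<bullet> a' + B\<^sup>2 / l"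
        using norm_diff_remote_bounds(2)[OF u na, of l] False R by linarith
      moreover have "B\<^sup>2 / l \<le> B\<^sup>2 / R" using False R by (intro divide_left_mono) auto
      ultimately show ?thesis using i a'(2) l by linarith
    qed
  qed
  have "hausdorff_dist ?G A \<le> R + (c - ?s) + B\<^sup>2 / R"
    unfolding hausdorff_dist_def using 1 2 A(2) by (auto intro!: cSUP_least)
  moreover have "R + (c - ?s) \<le> hausdorff_dist ?G A"
  proof -
    let ?e = "(R + c) *\<^sub>R u"
    have "R + c - ?s \<le> infdist ?e A"
      unfolding infdist_notempty[OF A(2)]
    proof (rule cINF_greatest[OF A(2)])
      fix a assume a: "a \<in> A"
      have "R + c - u \<bullet> a \<le> norm (?e - a)"
        using norm_diff_remote_bounds(1)[of u a B "R + c"] u A(3) a R c B by auto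
      moreover have "u \<bullet> a \<le> ?s" by (intro cSUP_upper a bdd_above_inner A)
      ultimately show "R + c - ?s \<le> dist ?e a" by (simp add: dist_norm)
    qed
    also have "\<dots> \<le> (SUP b\<in>?G. infdist b A)"
      by (intro cSUP_upper bdd_above_infdist) auto
    finally show ?thesis unfolding hausdorff_dist_def by linarith
  qed
  ultimately show ?thesis using q by linarith
qed

section \<open>Probing a fuzzy vector from far away\<close>

lemma alpha_cut_antimono:
  fixes x :: "'a::euclidean_space fuzzy"
  assumes "0 \<le> \<alpha>" "\<alpha> \<le> \<beta>"
  shows "alpha_cut x \<beta> \<subseteq> alpha_cut x \<alpha>"
proof (cases "\<alpha> = 0 \<and> 0 < \<beta>")
  case True
  have "{v. \<beta> \<le> x v} \<subseteq> {v. 0 < x v}" using True by auto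
  then show ?thesis using True closure_subset by (auto simp: alpha_cut_def)
next
  case False
  then show ?thesis using assms by (auto simp: alpha_cut_def)
qed

lemma fcconv_alpha_cut:
  assumes "x \<in> fcconv" "\<alpha> \<in> {0..1}"
  shows "compact (alpha_cut x \<alpha>)" "alpha_cut x \<alpha> \<noteq> {}"
  using assms by (auto simp: fcconv_def)

lemma fcconv_bounded_cuts:
  fixes x :: "'a::euclidean_space fuzzy"
  assumes "x \<in> fcconv"
  obtains B where "0 \<le> B" "\<And>\<alpha>. 0 \<le> \<alpha> \<Longrightarrow> alpha_cut x \<alpha> \<subseteq> cball 0 B"
proof -
  have "bounded (alpha_cut x 0)"
    by (intro compact_imp_bounded fcconv_alpha_cut assms) auto
  then obtain B where "alpha_cut x 0 \<subseteq> cball 0 B" "0 \<le> B"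
    by (metis bounded_subset_ballD subset_trans ball_subset_cball less_eq_real_def)
  then show ?thesis using that alpha_cut_antimono[of 0 _ x] by blast
qed

lemma supp_fun_antimono:
  assumes "x \<in> fcconv" "0 \<le> \<alpha>" "\<alpha> \<le> \<beta>" "\<beta> \<le> 1"
  shows "supp_fun x \<beta> u \<le> supp_fun x \<alpha> u"
  unfolding supp_fun_def
  by (intro cSUP_subset_mono bdd_above_inner fcconv_alpha_cut alpha_cut_antimono) (use assms in auto)

lemma borel_measurable_antimono_on:
  fixes f :: "real \<Rightarrow> real"
  assumes "\<And>x y. x \<in> A \<Longrightarrow> y \<in> A \<Longrightarrow> x \<le> y \<Longrightarrow> f y \<le> f x"
  shows "f \<in> borel_measurable (restrict_space borel A)"
proof -
  have "(\<lambda>x. - f x) \<in> borel_measurable (restrict_space borel A)"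
    using assms by (intro borel_measurable_mono_on_fnc) (auto intro!: mono_onI)
  from borel_measurable_uminus[OF this] show ?thesis by simp
qed

abbreviation unit_interval_measure :: "real measure" where
  "unit_interval_measure \<equiv> restrict_space lborel {0..1}"

lemma measurable_unit_interval_measure:
  "borel_measurable unit_interval_measure = borel_measurable (restrict_space borel {0..1::real})"
  by (rule measurable_cong_sets) (simp_all add: sets_restrict_space)

lemma prob_space_unit_interval_measure: "prob_space unit_interval_measure"
  by (rule prob_spaceI) (simp add: emeasure_restrict_space space_restrict_space)

lemma supp_fun_measurable_level:
  assumes "x \<in> fcconv"
  shows "(\<lambda>\<alpha>. supp_fun x \<alpha> u) \<in> borel_measurable unit_interval_measure"
  unfolding measurable_unit_interval_measure
  by (rule borel_measurable_antimono_on) (use assms in \<open>auto intro: supp_fun_antimono\<close>)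

text \<open>Both one-sided distances are monotone in the level, in opposite directions.\<close>

lemma hausdorff_dist_cut_measurable_level:
  fixes x :: "'a::euclidean_space fuzzy"
  assumes x: "x \<in> fcconv" and Y: "compact Y" "Y \<noteq> {}"
  shows "(\<lambda>\<alpha>. hausdorff_dist Y (alpha_cut x \<alpha>)) \<in> borel_measurable unit_interval_measure"
proof -
  have "(\<lambda>\<alpha>. SUP y\<in>Y. infdist y (alpha_cut x \<alpha>)) \<in> borel_measurable (restrict_space borel {0..1})"
  proof (intro borel_measurable_mono_on_fnc mono_onI)
    fix r s :: real assume rs: "r \<in> {0..1}" "s \<in> {0..1}" "r \<le> s"
    show "(SUP y\<in>Y. infdist y (alpha_cut x r)) \<le> (SUP y\<in>Y. infdist y (alpha_cut x s))"
    proof (rule cSUP_mono[OF Y(2) bdd_above_infdist[OF Y(1)]])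
      fix y assume y: "y \<in> Y"
      have "infdist y (alpha_cut x r) \<le> infdist y (alpha_cut x s)"
        using rs by (intro infdist_mono alpha_cut_antimono fcconv_alpha_cut x) auto
      then show "\<exists>z\<in>Y. infdist y (alpha_cut x r) \<le> infdist z (alpha_cut x s)" using y by blast
    qed
  qed
  moreover have "(\<lambda>\<alpha>. SUP a\<in>alpha_cut x \<alpha>. infdist a Y) \<in> borel_measurable (restrict_space borel {0..1})"
    by (intro borel_measurable_antimono_on cSUP_subset_mono bdd_above_infdist fcconv_alpha_cut
        alpha_cut_antimono x) auto
  ultimately show ?thesis
    unfolding hausdorff_dist_def measurable_unit_interval_measure by measurable
qed

text \<open>The distance to this fuzzy vector reads the support function with a minus sign up to level \<open>\<beta>\<close>,
  where its cut is the segment, and with a plus sign above, where its cut is the end \<open>- R u\<close>. For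
  \<open>\<beta> = 0\<close> it is the crisp point \<open>- R u\<close>.\<close>

definition probe :: "'a::euclidean_space \<Rightarrow> real \<Rightarrow> real \<Rightarrow> real \<Rightarrow> 'a fuzzy" where
  "probe u c \<beta> R v = (if v = - R *\<^sub>R u then 1
     else if v \<in> closed_segment (- R *\<^sub>R u) ((R + c) *\<^sub>R u) then \<beta> else 0)"

lemma alpha_cut_probe:
  assumes "\<beta> \<in> {0..1}" "\<alpha> \<in> {0..1}"
  shows "alpha_cut (probe u c \<beta> R) \<alpha> =
    (if \<alpha> \<le> \<beta> \<and> 0 < \<beta> then closed_segment (- R *\<^sub>R u) ((R + c) *\<^sub>R u) else {- R *\<^sub>R u})"
proof -
  have "{v. 0 < probe u c \<beta> R v} =
    (if 0 < \<beta> then closed_segment (- R *\<^sub>R u) ((R + c) *\<^sub>R u) else {- R *\<^sub>R u})"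
    using assms by (auto simp: probe_def split: if_splits)
  moreover have "{v. \<alpha> \<le> probe u c \<beta> R v} =
    (if \<alpha> \<le> \<beta> \<and> 0 < \<beta> then closed_segment (- R *\<^sub>R u) ((R + c) *\<^sub>R u) else {- R *\<^sub>R u})" if "\<alpha> \<noteq> 0"
    using assms that by (auto simp: probe_def split: if_splits)
  ultimately show ?thesis using assms by (auto simp: alpha_cut_def)
qed

lemma probe_in_fcconv:
  assumes "\<beta> \<in> {0..1}"
  shows "probe u c \<beta> R \<in> fcconv"
proof -
  have "bounded {v. probe u c \<beta> R v \<noteq> 0}"
    by (rule bounded_subset[OF bounded_closed_segment[of "- R *\<^sub>R u" "(R + c) *\<^sub>R u"]])
       (auto simp: probe_def split: if_splits)
  moreover have "0 \<le> probe u c \<beta> R v \<and> probe u c \<beta> R v \<le> 1" for v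
    using assms by (auto simp: probe_def)
  ultimately show ?thesis
    unfolding fcconv_def using alpha_cut_probe[OF assms, of _ u c R] by auto
qed

text \<open>The mean value theorem is applied to \<open>t \<mapsto> (n + t h)\<^sup>p\<close> on the unit interval, which treats both
  signs of \<open>h\<close> at once.\<close>

lemma powr_increment_mean_value:
  fixes p n h :: real
  assumes p: "1 \<le> p" and n: "\<bar>h\<bar> < n"
  obtains z where "\<bar>z - 1\<bar> \<le> \<bar>h\<bar> / n"
    "((n + h) powr p - n powr p) / (p * n powr (p - 1)) = h * z powr (p - 1)"
proof -
  have pos: "0 < n + t * h" if "0 \<le> t" "t \<le> 1" for t
  proof -
    have "\<bar>t * h\<bar> \<le> 1 * \<bar>h\<bar>" unfolding abs_mult by (rule mult_right_mono) (use that in auto)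
    then show ?thesis using n by linarith
  qed
  have "\<exists>t>0. t < 1 \<and> (n + 1 * h) powr p - (n + 0 * h) powr p = (1 - 0) * (p * (n + t * h) powr (p - 1) * h)"
  proof (rule MVT2)
    fix t :: real assume t: "0 \<le> t" "t \<le> 1"
    show "((\<lambda>t. (n + t * h) powr p) has_real_derivative p * (n + t * h) powr (p - 1) * h) (at t)"
      using pos[OF t] by (auto intro!: derivative_eq_intros)
  qed simp
  then obtain t where t: "0 < t" "t < 1" "(n + h) powr p - n powr p = p * (n + t * h) powr (p - 1) * h"
    by auto
  have n0: "0 < n" using n by linarith
  define z where "z = (n + t * h) / n"
  have "z - 1 = t * h / n" using n0 by (simp add: z_def field_simps)
  then have "\<bar>z - 1\<bar> \<le> \<bar>h\<bar> / n"
    using t n0 by (simp add: abs_mult divide_right_mono mult_le_cancel_right2)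
  moreover have "z powr (p - 1) = (n + t * h) powr (p - 1) / n powr (p - 1)"
    unfolding z_def using pos[of t] t n0 by (simp add: powr_divide)
  then have "((n + h) powr p - n powr p) / (p * n powr (p - 1)) = h * z powr (p - 1)"
    unfolding t(3) using p by simp
  ultimately show ?thesis using that by blast
qed

lemma powr_increment_bound:
  fixes p n h K :: real
  assumes "1 \<le> p" "\<bar>h\<bar> \<le> K" "K < n"
  shows "\<bar>((n + h) powr p - n powr p) / (p * n powr (p - 1))\<bar> \<le> K * 2 powr (p - 1)"
proof -
  obtain z where z: "\<bar>z - 1\<bar> \<le> \<bar>h\<bar> / n"
    "((n + h) powr p - n powr p) / (p * n powr (p - 1)) = h * z powr (p - 1)"
    using powr_increment_mean_value[of p h n] assms by (metis order_le_less_trans)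
  have "0 < n" using assms by linarith
  then have "\<bar>h\<bar> / n \<le> 1" using assms by simp
  then have "0 \<le> z" "z \<le> 2" using z(1) by linarith+
  then have "z powr (p - 1) \<le> 2 powr (p - 1)" using assms by (intro powr_mono2) auto
  then have "\<bar>h\<bar> * z powr (p - 1) \<le> K * 2 powr (p - 1)" using assms by (intro mult_mono) auto
  then show ?thesis unfolding z(2) by (simp add: abs_mult)
qed

lemma powr_increment_tendsto:
  fixes h n :: "nat \<Rightarrow> real"
  assumes p: "1 \<le> p" and h: "h \<longlonglongrightarrow> l" and n: "filterlim n at_top sequentially"
  shows "(\<lambda>k. ((n k + h k) powr p - n k powr p) / (p * n k powr (p - 1))) \<longlonglongrightarrow> l"
proof -
  have hn: "(\<lambda>k. \<bar>h k\<bar> / n k) \<longlonglongrightarrow> 0"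
    by (rule real_tendsto_divide_at_top[OF tendsto_rabs[OF h] n])
  have "\<forall>k. \<exists>z. \<bar>h k\<bar> < n k \<longrightarrow> \<bar>z - 1\<bar> \<le> \<bar>h k\<bar> / n k \<and>
    ((n k + h k) powr p - n k powr p) / (p * n k powr (p - 1)) = h k * z powr (p - 1)"
    by (metis powr_increment_mean_value[OF p])
  then obtain z where z: "\<And>k. \<bar>h k\<bar> < n k \<Longrightarrow> \<bar>z k - 1\<bar> \<le> \<bar>h k\<bar> / n k"
    "\<And>k. \<bar>h k\<bar> < n k \<Longrightarrow>
      ((n k + h k) powr p - n k powr p) / (p * n k powr (p - 1)) = h k * z k powr (p - 1)"
    by metis
  have ev: "\<forall>\<^sub>F k in sequentially. \<bar>h k\<bar> < n k"
  proof -
    have "\<forall>\<^sub>F k in sequentially. \<bar>h k\<bar> < \<bar>l\<bar> + 1" by (rule order_tendstoD(2)[OF tendsto_rabs[OF h]]) simp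
    moreover have "\<forall>\<^sub>F k in sequentially. \<bar>l\<bar> + 1 \<le> n k" using n by (simp add: filterlim_at_top)
    ultimately show ?thesis by eventually_elim linarith
  qed
  have "(\<lambda>k. z k - 1) \<longlonglongrightarrow> 0"
    by (rule Lim_null_comparison[OF _ hn]) (use ev in \<open>eventually_elim, auto intro: z\<close>)
  then have "z \<longlonglongrightarrow> 1" by (simp add: LIM_zero_iff)
  then have "(\<lambda>k. h k * z k powr (p - 1)) \<longlonglongrightarrow> l * 1 powr (p - 1)"
    by (intro tendsto_mult tendsto_powr h tendsto_const) auto
  then have "(\<lambda>k. h k * z k powr (p - 1)) \<longlonglongrightarrow> l" by simp
  then show ?thesis
    by (rule Lim_transform_eventually) (use ev in \<open>eventually_elim, auto simp: z(2)\<close>)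
qed

lemma fuzzy_dist_powr_eq_integral:
  assumes "1 \<le> p"
  shows "fuzzy_dist p y x powr p =
    (LINT \<alpha>|unit_interval_measure. hausdorff_dist (alpha_cut y \<alpha>) (alpha_cut x \<alpha>) powr p)"
proof -
  have "fuzzy_dist p y x =
    (LINT \<alpha>|unit_interval_measure. hausdorff_dist (alpha_cut y \<alpha>) (alpha_cut x \<alpha>) powr p) powr (1 / p)"
    unfolding fuzzy_dist_def set_lebesgue_integral_def by (subst integral_restrict_space) auto
  then show ?thesis using assms by (simp add: powr_powr integral_nonneg_AE)
qed

text \<open>After normalization, the \<open>p\<close>-th power of the distance to the probe is the integral of
  \<open>((R + h)\<^sup>p - R\<^sup>p) / (p R\<^sup>p\<^sup>-\<^sup>1)\<close>, where \<open>h\<close> is the bounded excess of the Hausdorff distance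
  over \<open>R\<close>. This expression tends to \<open>lim h\<close> for every exponent \<open>p\<close>, so the limit of the
  normalized distances does not depend on \<open>p\<close>.\<close>

lemma probe_dist_tendsto:
  fixes x :: "'a::euclidean_space fuzzy"
  assumes x: "x \<in> fcconv" and u: "norm u = 1" and p: "1 \<le> p" and \<beta>: "\<beta> \<in> {0..1}"
    and B: "\<And>\<alpha>. 0 \<le> \<alpha> \<Longrightarrow> alpha_cut x \<alpha> \<subseteq> cball 0 B" "0 \<le> B" and c: "2 * B \<le> c"
  shows "(\<lambda>n. (fuzzy_dist p (probe u c \<beta> (real n)) x powr p - real n powr p) / (p * real n powr (p - 1)))
    \<longlonglongrightarrow> (LINT \<alpha>|unit_interval_measure. (if \<alpha> \<le> \<beta> \<and> 0 < \<beta> then c - supp_fun x \<alpha> u else supp_fun x \<alpha> u))"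
proof -
  interpret U: prob_space unit_interval_measure by (rule prob_space_unit_interval_measure)
  define H where "H n \<alpha> = hausdorff_dist (alpha_cut (probe u c \<beta> (real n)) \<alpha>) (alpha_cut x \<alpha>)" for n \<alpha>
  define g where "g \<alpha> = (if \<alpha> \<le> \<beta> \<and> 0 < \<beta> then c - supp_fun x \<alpha> u else supp_fun x \<alpha> u)" for \<alpha>
  define q where "q n \<alpha> = (H n \<alpha> powr p - real n powr p) / (p * real n powr (p - 1))" for n \<alpha>
  define K where "K = c + 2 * B + 1"
  have s: "\<bar>supp_fun x \<alpha> u\<bar> \<le> B" if "\<alpha> \<in> {0..1}" for \<alpha>
    unfolding supp_fun_def using that by (intro abs_SUP_inner_le B fcconv_alpha_cut x u) auto
  have g: "\<bar>g \<alpha>\<bar> \<le> c + B" if "\<alpha> \<in> {0..1}" for \<alpha>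
    using s[OF that] B c by (auto simp: g_def)
  have Hg: "\<bar>H n \<alpha> - (real n + g \<alpha>)\<bar> \<le> B\<^sup>2 / real n"
    if n: "0 < n" "2 * B \<le> real n" and \<alpha>: "\<alpha> \<in> {0..1}" for n \<alpha>
  proof -
    have A: "compact (alpha_cut x \<alpha>)" "alpha_cut x \<alpha> \<noteq> {}" "alpha_cut x \<alpha> \<subseteq> cball 0 B"
      using fcconv_alpha_cut[OF x \<alpha>] B \<alpha> by auto
    show ?thesis
      using hausdorff_dist_remote_point[OF A u, of "real n"] hausdorff_dist_remote_segment[OF A u, of "real n" c] n c
      unfolding H_def g_def alpha_cut_probe[OF \<beta> \<alpha>] supp_fun_def by auto
  qed
  have Hmeas [measurable]: "H n \<in> borel_measurable unit_interval_measure" for n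
  proof -
    let ?G = "closed_segment (- real n *\<^sub>R u) ((real n + c) *\<^sub>R u)"
    have [measurable]: "(\<lambda>\<alpha>. hausdorff_dist ?G (alpha_cut x \<alpha>)) \<in> borel_measurable unit_interval_measure"
      "(\<lambda>\<alpha>. hausdorff_dist {- real n *\<^sub>R u} (alpha_cut x \<alpha>)) \<in> borel_measurable unit_interval_measure"
      by (intro hausdorff_dist_cut_measurable_level x; simp)+
    have [measurable]: "{..\<beta>} \<inter> {0..1} \<in> sets unit_interval_measure"
      by (auto simp: sets_restrict_space)
    have "(\<lambda>\<alpha>. if \<alpha> \<in> {..\<beta>} \<inter> {0..1} \<and> 0 < \<beta> then hausdorff_dist ?G (alpha_cut x \<alpha>)
        else hausdorff_dist {- real n *\<^sub>R u} (alpha_cut x \<alpha>)) \<in> borel_measurable unit_interval_measure"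
      by measurable
    then show ?thesis
      by (rule measurable_cong[THEN iffD1, rotated])
        (auto simp: H_def alpha_cut_probe[OF \<beta>] space_restrict_space)
  qed
  \<comment> \<open>From \<open>n0\<close> on, the probe lies far enough away for all the estimates above.\<close>
  obtain n0 :: nat where n0: "K + B\<^sup>2 < real n0" using reals_Archimedean2 by blast
  have big: "K < real n" "0 < n" "2 * B \<le> real n" "B\<^sup>2 / real n \<le> 1" if "n0 \<le> n" for n
  proof -
    have "0 \<le> B\<^sup>2" by simp
    then show a: "K < real n" using n0 that by linarith
    then show "0 < n" "2 * B \<le> real n" using B c by (auto simp: K_def intro: gr0I)
    have "B\<^sup>2 \<le> real n" using n0 that B c by (simp add: K_def)
    then show "B\<^sup>2 / real n \<le> 1" using \<open>0 < n\<close> by simp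
  qed
  have h: "\<bar>H n \<alpha> - real n\<bar> \<le> K" if "n0 \<le> n" "\<alpha> \<in> {0..1}" for n \<alpha>
    using Hg[OF big(2,3)[OF that(1)] that(2)] big(4)[OF that(1)] g[OF that(2)] B(2) unfolding K_def by linarith
  have qbound: "\<bar>q n \<alpha>\<bar> \<le> K * 2 powr (p - 1)" if "n0 \<le> n" "\<alpha> \<in> {0..1}" for n \<alpha>
    using powr_increment_bound[OF p h[OF that] big(1)[OF that(1)]] by (simp add: q_def)
  have qlim: "(\<lambda>n. q n \<alpha>) \<longlonglongrightarrow> g \<alpha>" if \<alpha>: "\<alpha> \<in> {0..1}" for \<alpha>
  proof -
    have "(\<lambda>n. (H n \<alpha> - real n) - g \<alpha>) \<longlonglongrightarrow> 0"
    proof (rule Lim_null_comparison)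
      show "\<forall>\<^sub>F n in sequentially. norm ((H n \<alpha> - real n) - g \<alpha>) \<le> B\<^sup>2 / real n"
        using eventually_ge_at_top[of n0]
        by eventually_elim (use Hg[OF big(2,3) \<alpha>] in \<open>simp add: algebra_simps\<close>)
      show "(\<lambda>n. B\<^sup>2 / real n) \<longlonglongrightarrow> 0"
        by (rule real_tendsto_divide_at_top[OF tendsto_const filterlim_real_sequentially])
    qed
    then have "(\<lambda>n. H n \<alpha> - real n) \<longlonglongrightarrow> g \<alpha>" by (simp add: LIM_zero_iff)
    from powr_increment_tendsto[OF p this filterlim_real_sequentially]
    show ?thesis by (simp add: q_def)
  qed
  have int: "(fuzzy_dist p (probe u c \<beta> (real n)) x powr p - real n powr p) / (p * real n powr (p - 1))
    = (LINT \<alpha>|unit_interval_measure. q n \<alpha>)" if "n0 \<le> n" for n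
  proof -
    have "integrable unit_interval_measure (\<lambda>\<alpha>. H n \<alpha> powr p)"
    proof (rule U.integrable_const_bound)
      have "norm (H n \<alpha> powr p) \<le> (real n + K) powr p" if "\<alpha> \<in> {0..1}" for \<alpha>
      proof -
        have "H n \<alpha> \<le> real n + K" "0 \<le> H n \<alpha>"
          using h[OF \<open>n0 \<le> n\<close> that] big(1)[OF \<open>n0 \<le> n\<close>] by linarith+
        then show ?thesis using p by (auto intro!: powr_mono2)
      qed
      then show "AE \<alpha> in unit_interval_measure. norm (H n \<alpha> powr p) \<le> (real n + K) powr p"
        by (intro AE_I2) (auto simp: space_restrict_space)
    qed measurable
    then show ?thesis
      unfolding fuzzy_dist_powr_eq_integral[OF p] q_def H_def[symmetric]
      using U.prob_space by (simp add: space_restrict_space diff_divide_distrib)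
  qed
  have "(\<lambda>n. LINT \<alpha>|unit_interval_measure. q (n + n0) \<alpha>) \<longlonglongrightarrow> (LINT \<alpha>|unit_interval_measure. g \<alpha>)"
  proof (rule integral_dominated_convergence)
    have lim: "(\<lambda>n. q (n + n0) \<alpha>) \<longlonglongrightarrow> g \<alpha>" if "\<alpha> \<in> {0..1}" for \<alpha>
      by (rule LIMSEQ_ignore_initial_segment[OF qlim[OF that]])
    show qm: "q (n + n0) \<in> borel_measurable unit_interval_measure" for n
      unfolding q_def by measurable
    show "g \<in> borel_measurable unit_interval_measure"
      by (rule borel_measurable_LIMSEQ_real[where u = "\<lambda>n. q (n + n0)", OF _ qm])
        (use lim in \<open>auto simp: space_restrict_space\<close>)
    show "AE \<alpha> in unit_interval_measure. (\<lambda>n. q (n + n0) \<alpha>) \<longlonglongrightarrow> g \<alpha>"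
      by (intro AE_I2) (use lim in \<open>auto simp: space_restrict_space\<close>)
    show "AE \<alpha> in unit_interval_measure. norm (q (n + n0) \<alpha>) \<le> K * 2 powr (p - 1)" for n
      by (intro AE_I2) (use qbound in \<open>auto simp: space_restrict_space\<close>)
  qed auto
  then have "(\<lambda>n. LINT \<alpha>|unit_interval_measure. q n \<alpha>) \<longlonglongrightarrow> (LINT \<alpha>|unit_interval_measure. g \<alpha>)"
    by (rule LIMSEQ_offset)
  then show ?thesis
    unfolding g_def[symmetric]
    by (rule Lim_transform_eventually)
      (use eventually_ge_at_top[of n0] in \<open>eventually_elim, simp add: int\<close>)
qed

section \<open>Measurability of the support function\<close>

lemma space_fuzzy_borel: "space (fuzzy_borel p) = fcconv"
  unfolding fuzzy_borel_def by (rule space_measure_of) auto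

lemma fuzzy_dist_measurable:
  assumes y: "y \<in> fcconv"
  shows "fuzzy_dist p y \<in> borel_measurable (fuzzy_borel p)"
proof (rule borel_measurableI_less)
  fix r
  show "{x \<in> space (fuzzy_borel p). fuzzy_dist p y x < r} \<in> sets (fuzzy_borel p)"
  proof (cases "0 < r")
    case True
    have "{x \<in> fcconv. fuzzy_dist p y x < r} \<in> {{y \<in> fcconv. fuzzy_dist p x y < r} |x r. x \<in> fcconv \<and> 0 < r}"
      using y True by blast
    then show ?thesis unfolding space_fuzzy_borel unfolding fuzzy_borel_def
      by (intro in_measure_of) auto
  next
    case False
    have "0 \<le> fuzzy_dist p y x" for x unfolding fuzzy_dist_def by simp
    then have "{x \<in> space (fuzzy_borel p). fuzzy_dist p y x < r} = {}"
      using False by (auto simp: not_less intro: order_trans)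
    then show ?thesis by (simp only: sets.empty_sets)
  qed
qed

text \<open>The probe is informative only if \<open>c\<close> is large compared with the support of \<open>x\<close>, and no \<open>c\<close> serves all \<open>x\<close>.
  Therefore a second limit \<open>c \<rightarrow> \<infinity>\<close> is taken, along which the values are eventually constant for
  each \<open>x\<close>.\<close>

lemma signed_supp_fun_integral_measurable:
  fixes u :: "'a::euclidean_space"
  assumes u: "norm u = 1" and p: "1 \<le> p" and \<beta>: "\<beta> \<in> {0..1}"
  shows "(\<lambda>x. LINT \<alpha>|unit_interval_measure. (if \<alpha> \<le> \<beta> \<and> 0 < \<beta> then - supp_fun x \<alpha> u else supp_fun x \<alpha> u))
    \<in> borel_measurable (fuzzy_borel p)"
proof (rule borel_measurable_LIMSEQ_real)
  let ?incr = "\<lambda>c x n. (fuzzy_dist p (probe u c \<beta> (real n)) x powr p - real n powr p) / (p * real n powr (p - 1))"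
  let ?C = "\<lambda>c. LINT \<alpha>|unit_interval_measure. (if \<alpha> \<le> \<beta> \<and> 0 < \<beta> then c else 0)"
  note [measurable] = fuzzy_dist_measurable[OF probe_in_fcconv[OF \<beta>]]
  show "(\<lambda>x. lim (?incr (real k) x) - ?C (real k)) \<in> borel_measurable (fuzzy_borel p)" for k :: nat
    by measurable
  fix x :: "'a fuzzy" assume "x \<in> space (fuzzy_borel p)"
  then have x: "x \<in> fcconv" by (simp add: space_fuzzy_borel)
  interpret U: prob_space unit_interval_measure by (rule prob_space_unit_interval_measure)
  obtain B where B: "0 \<le> B" "\<And>\<alpha>. 0 \<le> \<alpha> \<Longrightarrow> alpha_cut x \<alpha> \<subseteq> cball 0 B"
    using fcconv_bounded_cuts[OF x] by blast
  have s: "\<bar>supp_fun x \<alpha> u\<bar> \<le> B" if "\<alpha> \<in> {0..1}" for \<alpha>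
    unfolding supp_fun_def using that by (intro abs_SUP_inner_le B fcconv_alpha_cut x u) auto
  note [measurable] = supp_fun_measurable_level[OF x, of u]
  have [measurable]: "(\<lambda>\<alpha>. \<alpha>) \<in> borel_measurable unit_interval_measure"
    by (rule measurable_restrict_space1) simp
  have eq: "lim (?incr (real k) x) - ?C (real k) =
      (LINT \<alpha>|unit_interval_measure. (if \<alpha> \<le> \<beta> \<and> 0 < \<beta> then - supp_fun x \<alpha> u else supp_fun x \<alpha> u))"
    if "2 * B \<le> real k" for k
  proof -
    have "lim (?incr (real k) x) = (LINT \<alpha>|unit_interval_measure. (if \<alpha> \<le> \<beta> \<and> 0 < \<beta> then real k - supp_fun x \<alpha> u else supp_fun x \<alpha> u))"
      by (rule limI, rule probe_dist_tendsto[OF x u p \<beta> B(2,1) that])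
    also have "\<dots> = (LINT \<alpha>|unit_interval_measure. (if \<alpha> \<le> \<beta> \<and> 0 < \<beta> then real k else 0) +
        (if \<alpha> \<le> \<beta> \<and> 0 < \<beta> then - supp_fun x \<alpha> u else supp_fun x \<alpha> u))"
      by (rule Bochner_Integration.integral_cong) auto
    also have "\<dots> = ?C (real k) + (LINT \<alpha>|unit_interval_measure. (if \<alpha> \<le> \<beta> \<and> 0 < \<beta> then - supp_fun x \<alpha> u else supp_fun x \<alpha> u))"
    proof (rule Bochner_Integration.integral_add)
      show "integrable unit_interval_measure (\<lambda>\<alpha>. if \<alpha> \<le> \<beta> \<and> 0 < \<beta> then real k else 0)"
        by (rule U.integrable_const_bound[of _ "real k"]) (auto intro!: AE_I2)
      show "integrable unit_interval_measure (\<lambda>\<alpha>. if \<alpha> \<le> \<beta> \<and> 0 < \<beta> then - supp_fun x \<alpha> u else supp_fun x \<alpha> u)"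
        by (rule U.integrable_const_bound[of _ B]) (use s in \<open>auto intro!: AE_I2 simp: space_restrict_space\<close>)
    qed
    finally show ?thesis by simp
  qed
  obtain k0 :: nat where "2 * B \<le> real k0" using real_arch_simple by blast
  then have "\<forall>\<^sub>F k in sequentially. (LINT \<alpha>|unit_interval_measure. (if \<alpha> \<le> \<beta> \<and> 0 < \<beta> then - supp_fun x \<alpha> u else supp_fun x \<alpha> u)) = lim (?incr (real k) x) - ?C (real k)"
    by (intro eventually_sequentiallyI[of k0]) (subst eq, auto)
  then show "(\<lambda>k. lim (?incr (real k) x) - ?C (real k)) \<longlonglongrightarrow>
     (LINT \<alpha>|unit_interval_measure. (if \<alpha> \<le> \<beta> \<and> 0 < \<beta> then - supp_fun x \<alpha> u else supp_fun x \<alpha> u))"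
    by (rule Lim_transform_eventually[OF tendsto_const])
qed

text \<open>The cut at level \<open>\<alpha>\<close> is the intersection of the compact cuts at the levels \<open>b k\<close>; a support function
  that stayed above its value at \<open>\<alpha>\<close> would, by compactness, be witnessed by a point of this
  intersection.\<close>

lemma supp_fun_left_continuous:
  fixes x :: "'a::euclidean_space fuzzy"
  assumes x: "x \<in> fcconv" and \<alpha>: "\<alpha> \<le> 1"
    and b: "\<And>k::nat. 0 < b k" "\<And>k. b k \<le> \<alpha>" "mono b" "b \<longlonglongrightarrow> \<alpha>"
  shows "(\<lambda>k. supp_fun x (b k) u) \<longlonglongrightarrow> supp_fun x \<alpha> u"
proof -
  have b0: "0 \<le> b k" "b k \<in> {0..1}" for k using b(1,2)[of k] \<alpha> by auto
  have \<alpha>0: "0 < \<alpha>" using b(1,2)[of 0] by linarith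
  have dec: "decseq (\<lambda>k. supp_fun x (b k) u)"
    unfolding decseq_def using b(3) b0 by (auto intro!: supp_fun_antimono x dest: monoD)
  have lower: "supp_fun x \<alpha> u \<le> supp_fun x (b k) u" for k
    using b(2) b0 \<alpha> by (intro supp_fun_antimono x) auto
  have upper: "\<exists>k. supp_fun x (b k) u < supp_fun x \<alpha> u + e" if e: "0 < e" for e
  proof (rule ccontr)
    assume "\<not> ?thesis"
    then have large: "supp_fun x \<alpha> u + e \<le> supp_fun x (b k) u" for k by (simp add: not_less)
    \<comment> \<open>Half of the gap \<open>e\<close> is given up so that the supremum yields a point in each \<open>K k\<close>.\<close>
    define K where "K k = alpha_cut x (b k) \<inter> {v. supp_fun x \<alpha> u + e / 2 \<le> u \<bullet> v}" for k
    have "\<Inter> (range K) \<noteq> {}"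
    proof (rule compact_nest)
      fix k
      show "compact (K k)" unfolding K_def
        by (intro compact_Int_closed fcconv_alpha_cut[OF x] closed_Collect_le continuous_intros b0)
      have "supp_fun x \<alpha> u + e / 2 < (SUP a\<in>alpha_cut x (b k). u \<bullet> a)"
        using large[of k] e unfolding supp_fun_def by linarith
      then obtain a where "a \<in> alpha_cut x (b k)" "supp_fun x \<alpha> u + e / 2 < u \<bullet> a"
        using less_cSUP_iff[OF fcconv_alpha_cut(2)[OF x b0(2)] bdd_above_inner[OF fcconv_alpha_cut(1)[OF x b0(2)]]]
        by blast
      then show "K k \<noteq> {}" unfolding K_def by force
    next
      fix i k :: nat assume "i \<le> k"
      then show "K k \<subseteq> K i"
        unfolding K_def using alpha_cut_antimono[of "b i" "b k" x] b0(1) b(3) by (auto dest: monoD)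
    qed
    then obtain v where v: "\<And>k. v \<in> K k" by auto
    have "b k \<le> x v" for k using v[of k] b(1)[of k] by (simp add: K_def alpha_cut_def)
    then have "\<alpha> \<le> x v" using b(4) by (auto intro: LIMSEQ_le_const2)
    then have "v \<in> alpha_cut x \<alpha>" using \<alpha>0 by (simp add: alpha_cut_def)
    then have "u \<bullet> v \<le> supp_fun x \<alpha> u"
      unfolding supp_fun_def using \<alpha> \<alpha>0 by (intro cSUP_upper bdd_above_inner fcconv_alpha_cut x) auto
    then show False using v[of 0] e by (simp add: K_def)
  qed
  show ?thesis
  proof (rule LIMSEQ_I)
    fix e :: real assume "0 < e"
    then obtain k0 where k0: "supp_fun x (b k0) u < supp_fun x \<alpha> u + e" using upper by blast
    have "norm (supp_fun x (b k) u - supp_fun x \<alpha> u) < e" if "k0 \<le> k" for k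
      using decseqD[OF dec that] lower[of k] k0 by simp
    then show "\<exists>k0. \<forall>k\<ge>k0. norm (supp_fun x (b k) u - supp_fun x \<alpha> u) < e" by blast
  qed
qed

text \<open>The difference of the signed integrals for two levels \<open>b k < \<alpha>\<close> is twice the integral of the
  support function over \<open>(b k, \<alpha>]\<close>. By monotonicity its mean value lies between the values at the
  two ends.\<close>

theorem supp_fun_measurable:
  fixes u :: "'a::euclidean_space"
  assumes u: "norm u = 1" and p: "1 \<le> p" and \<alpha>: "\<alpha> \<in> {0<..1}"
  shows "(\<lambda>x. supp_fun x \<alpha> u) \<in> borel_measurable (fuzzy_borel p)"
proof (rule borel_measurable_LIMSEQ_real)
  \<comment> \<open>The shift by 2 keeps the levels \<open>b k\<close> positive.\<close>
  define b where "b k = \<alpha> - \<alpha> / (real k + 2)" for k :: nat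
  let ?\<Psi> = "\<lambda>\<beta> x. LINT \<gamma>|unit_interval_measure. (if \<gamma> \<le> \<beta> \<and> 0 < \<beta> then - supp_fun x \<gamma> u else supp_fun x \<gamma> u)"
  let ?mean = "\<lambda>k x. (?\<Psi> (b k) x - ?\<Psi> \<alpha> x) / (2 * (\<alpha> - b k))"
  have b: "0 < b k" "b k < \<alpha>" for k
  proof -
    have "\<alpha> / (real k + 2) < \<alpha>" "0 < \<alpha> / (real k + 2)" using \<alpha> by (auto simp: divide_simps)
    then show "0 < b k" "b k < \<alpha>" by (auto simp: b_def)
  qed
  have "mono b"
    using \<alpha> by (auto simp: mono_def b_def intro!: divide_left_mono)
  have "(\<lambda>k. \<alpha> / (real k + 2)) \<longlonglongrightarrow> 0"
    using LIMSEQ_ignore_initial_segment[OF lim_const_over_n[of \<alpha>], of 2] by (simp add: add.commute)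
  from tendsto_diff[OF tendsto_const this] have "b \<longlonglongrightarrow> \<alpha>" unfolding b_def by fastforce
  show "?mean k \<in> borel_measurable (fuzzy_borel p)" for k
  proof -
    have [measurable]: "?\<Psi> (b k) \<in> borel_measurable (fuzzy_borel p)" "?\<Psi> \<alpha> \<in> borel_measurable (fuzzy_borel p)"
      by (rule signed_supp_fun_integral_measurable[OF u p], use b[of k] \<alpha> in force)+
    show ?thesis by measurable
  qed
  fix x :: "'a fuzzy" assume "x \<in> space (fuzzy_borel p)"
  then have x: "x \<in> fcconv" by (simp add: space_fuzzy_borel)
  interpret U: prob_space unit_interval_measure by (rule prob_space_unit_interval_measure)
  obtain B where B: "0 \<le> B" "\<And>\<alpha>. 0 \<le> \<alpha> \<Longrightarrow> alpha_cut x \<alpha> \<subseteq> cball 0 B"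
    using fcconv_bounded_cuts[OF x] by blast
  have s: "\<bar>supp_fun x \<gamma> u\<bar> \<le> B" if "\<gamma> \<in> {0..1}" for \<gamma>
    unfolding supp_fun_def using that by (intro abs_SUP_inner_le B fcconv_alpha_cut x u) auto
  note [measurable] = supp_fun_measurable_level[OF x, of u]
  have [measurable]: "(\<lambda>\<alpha>. \<alpha>) \<in> borel_measurable unit_interval_measure"
    by (rule measurable_restrict_space1) simp
  have int: "integrable unit_interval_measure (\<lambda>\<gamma>. if \<gamma> \<le> \<beta> \<and> 0 < \<beta> then - supp_fun x \<gamma> u else supp_fun x \<gamma> u)" for \<beta>
    by (rule U.integrable_const_bound[of _ B]) (use s in \<open>auto intro!: AE_I2 simp: space_restrict_space\<close>)
  have cont: "(\<lambda>k. supp_fun x (b k) u) \<longlonglongrightarrow> supp_fun x \<alpha> u"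
    using b \<alpha> \<open>mono b\<close> \<open>b \<longlonglongrightarrow> \<alpha>\<close> by (intro supp_fun_left_continuous x) (auto intro: less_imp_le)
  have mean: "supp_fun x \<alpha> u \<le> ?mean k x \<and> ?mean k x \<le> supp_fun x (b k) u" for k
  proof -
    let ?I = "{b k<..\<alpha>}"
    have Iset [measurable]: "?I \<in> sets unit_interval_measure"
      using b[of k] \<alpha> by (auto simp: sets_restrict_space intro!: image_eqI[of _ _ ?I])
    have mI: "measure unit_interval_measure ?I = \<alpha> - b k"
      using b[of k] \<alpha> by (subst measure_restrict_space) auto
    have diff: "?\<Psi> (b k) x - ?\<Psi> \<alpha> x = (LINT \<gamma>|unit_interval_measure. 2 * (indicator ?I \<gamma> * supp_fun x \<gamma> u))"
      unfolding Bochner_Integration.integral_diff[OF int int, symmetric]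
      by (rule Bochner_Integration.integral_cong) (use b[of k] \<alpha> in \<open>auto simp: indicator_def\<close>)
    have ii: "integrable unit_interval_measure (\<lambda>\<gamma>. indicator ?I \<gamma> * supp_fun x \<gamma> u)"
      by (rule U.integrable_const_bound[of _ B])
        (use s B(1) in \<open>auto intro!: AE_I2 simp: space_restrict_space indicator_def\<close>)
    have ic: "integrable unit_interval_measure (\<lambda>\<gamma>. indicator ?I \<gamma> * a)" for a :: real
      by (rule U.integrable_const_bound[of _ "\<bar>a\<bar>"]) (auto intro!: AE_I2 simp: indicator_def)
    have ci: "(LINT \<gamma>|unit_interval_measure. indicator ?I \<gamma> * a) = (\<alpha> - b k) * a" for a
    proof -
      have "?I \<inter> {0..1} = ?I" using b[of k] \<alpha> by auto
      then show ?thesis by (simp add: mI space_restrict_space)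
    qed
    have "(\<alpha> - b k) * supp_fun x \<alpha> u \<le> (LINT \<gamma>|unit_interval_measure. indicator ?I \<gamma> * supp_fun x \<gamma> u)"
      unfolding ci[symmetric] using b[of k] \<alpha>
      by (intro integral_mono ic ii) (auto simp: indicator_def intro!: supp_fun_antimono x)
    moreover have "(LINT \<gamma>|unit_interval_measure. indicator ?I \<gamma> * supp_fun x \<gamma> u) \<le> (\<alpha> - b k) * supp_fun x (b k) u"
      unfolding ci[symmetric] using b[of k] \<alpha>
      by (intro integral_mono ic ii) (auto simp: indicator_def intro!: supp_fun_antimono x)
    moreover have "?mean k x = (LINT \<gamma>|unit_interval_measure. indicator ?I \<gamma> * supp_fun x \<gamma> u) / (\<alpha> - b k)"
      unfolding diff using b[of k] by (subst integral_mult_right_zero) (simp add: divide_simps)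
    ultimately show ?thesis using b[of k] by (simp add: pos_le_divide_eq pos_divide_le_eq mult.commute)
  qed
  show "(\<lambda>k. ?mean k x) \<longlonglongrightarrow> supp_fun x \<alpha> u"
    by (rule tendsto_sandwich[OF _ _ tendsto_const cont]) (use mean in auto)
qed

section \<open>Support functions of fuzzy sums\<close>

lemma supp_fun_fuzzy_add:
  fixes x y :: "'a::euclidean_space fuzzy"
  assumes x: "x \<in> fcconv" and y: "y \<in> fcconv" and \<alpha>: "\<alpha> \<in> {0<..1}"
  shows "supp_fun (fuzzy_add x y) \<alpha> u = supp_fun x \<alpha> u + supp_fun y \<alpha> u"
proof -
  let ?A = "alpha_cut x \<alpha>" and ?B = "alpha_cut y \<alpha>"
  have \<alpha>': "\<alpha> \<in> {0..1}" using \<alpha> by auto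
  have A: "compact ?A" "?A \<noteq> {}" and B: "compact ?B" "?B \<noteq> {}"
    using fcconv_alpha_cut[OF x \<alpha>'] fcconv_alpha_cut[OF y \<alpha>'] by auto
  have C: "compact (?A + ?B)" "?A + ?B \<noteq> {}"
    using fcconv_alpha_cut[OF fuzzy_add_cuts(1)[OF x y] \<alpha>'] fuzzy_add_cuts(2)[OF x y \<alpha>] by auto
  have "(SUP c\<in>?A + ?B. u \<bullet> c) \<le> (SUP a\<in>?A. u \<bullet> a) + (SUP b\<in>?B. u \<bullet> b)"
  proof (rule cSUP_least[OF C(2)])
    fix c assume "c \<in> ?A + ?B"
    then obtain a b where "c = a + b" "a \<in> ?A" "b \<in> ?B" by (auto simp: set_plus_def)
    then show "u \<bullet> c \<le> (SUP a\<in>?A. u \<bullet> a) + (SUP b\<in>?B. u \<bullet> b)"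
      by (auto simp: inner_add_right intro!: add_mono cSUP_upper bdd_above_inner A B)
  qed
  moreover have "(SUP a\<in>?A. u \<bullet> a) \<le> (SUP c\<in>?A + ?B. u \<bullet> c) - (SUP b\<in>?B. u \<bullet> b)"
  proof (rule cSUP_least[OF A(2)])
    fix a assume a: "a \<in> ?A"
    have "(SUP b\<in>?B. u \<bullet> b) \<le> (SUP c\<in>?A + ?B. u \<bullet> c) - u \<bullet> a"
    proof (rule cSUP_least[OF B(2)])
      fix b assume "b \<in> ?B"
      then have "u \<bullet> (a + b) \<le> (SUP c\<in>?A + ?B. u \<bullet> c)"
        using a by (intro cSUP_upper bdd_above_inner C set_plus_intro)
      then show "u \<bullet> b \<le> (SUP c\<in>?A + ?B. u \<bullet> c) - u \<bullet> a" by (simp add: inner_add_right)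
    qed
    then show "u \<bullet> a \<le> (SUP c\<in>?A + ?B. u \<bullet> c) - (SUP b\<in>?B. u \<bullet> b)" by simp
  qed
  ultimately show ?thesis unfolding supp_fun_def fuzzy_add_cuts(2)[OF x y \<alpha>] by simp
qed

lemma alpha_cut_fuzzy_zero: "\<alpha> \<in> {0..1} \<Longrightarrow> alpha_cut fuzzy_zero \<alpha> = {0}"
  by (auto simp: alpha_cut_def fuzzy_zero_def indicator_def split: if_splits)

lemma fuzzy_zero_in_fcconv: "fuzzy_zero \<in> fcconv"
proof -
  have "bounded {v. fuzzy_zero v \<noteq> 0}"
    by (rule bounded_subset[of "{0}"]) (auto simp: fuzzy_zero_def indicator_def)
  then show ?thesis
    unfolding fcconv_def by (simp add: alpha_cut_fuzzy_zero) (simp add: fuzzy_zero_def)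
qed

lemma supp_fun_fuzzy_partial_sum:
  assumes \<alpha>: "\<alpha> \<in> {0<..1}" and X: "\<And>i. 1 \<le> i \<Longrightarrow> X i \<omega> \<in> fcconv"
  shows "supp_fun (fuzzy_partial_sum X k \<omega>) \<alpha> u = (\<Sum>i\<in>{0<..k}. supp_fun (X i \<omega>) \<alpha> u)"
proof -
  have "fuzzy_partial_sum X k \<omega> \<in> fcconv \<and>
    supp_fun (fuzzy_partial_sum X k \<omega>) \<alpha> u = (\<Sum>i\<in>{0<..k}. supp_fun (X i \<omega>) \<alpha> u)"
  proof (induction k)
    case 0
    then show ?case
      using \<alpha> by (simp add: fuzzy_zero_in_fcconv supp_fun_def alpha_cut_fuzzy_zero)
  next
    case (Suc k)
    have "{0<..Suc k} = insert (Suc k) {0<..k}" by auto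
    then show ?case
      using Suc X[of "Suc k"] \<alpha> by (simp add: fuzzy_add_cuts(1) supp_fun_fuzzy_add)
  qed
  then show ?thesis ..
qed

section \<open>Independence and equality in law\<close>

text \<open>Reindexing is the case of disjoint blocks that are singletons.\<close>

lemma (in prob_space) indep_vars_inj_reindex:
  assumes "indep_vars (\<lambda>_. N) Y I" "inj_on h L" "h ` L \<subseteq> I"
  shows "indep_vars (\<lambda>_. N) (\<lambda>j. Y (h j)) L"
proof -
  have "indep_vars (\<lambda>j. PiM {h j} (\<lambda>_. N)) (\<lambda>j \<omega>. restrict (\<lambda>i. Y i \<omega>) {h j}) L"
    using assms by (intro indep_vars_restrict) (auto simp: disjoint_family_on_def inj_on_def)
  from indep_vars_compose2[OF this, of "\<lambda>j f. f (h j)" "\<lambda>_. N"] show ?thesis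
    by (auto simp: measurable_component_singleton)
qed

text \<open>The joint law of an independent family is the product of the marginal laws.\<close>

lemma distr_indep_vars_eq:
  assumes M: "prob_space M" and P: "prob_space P" and "I \<noteq> {}"
    and V: "prob_space.indep_vars M (\<lambda>_. N) V I" and W: "prob_space.indep_vars P (\<lambda>_. N) W I"
    and eq: "\<And>i. i \<in> I \<Longrightarrow> distr M N (V i) = distr P N (W i)"
  shows "distr M (PiM I (\<lambda>_. N)) (\<lambda>\<omega>. \<lambda>i\<in>I. V i \<omega>) = distr P (PiM I (\<lambda>_. N)) (\<lambda>\<omega>. \<lambda>i\<in>I. W i \<omega>)"
proof -
  have 1: "V i \<in> measurable M N" if "i \<in> I" for i
    using V that unfolding prob_space.indep_vars_def2[OF M] by auto
  have 2: "W i \<in> measurable P N" if "i \<in> I" for i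
    using W that unfolding prob_space.indep_vars_def2[OF P] by auto
  have "distr M (PiM I (\<lambda>_. N)) (\<lambda>\<omega>. \<lambda>i\<in>I. V i \<omega>) = PiM I (\<lambda>i. distr M N (V i))"
    using prob_space.indep_vars_iff_distr_eq_PiM'[OF M \<open>I \<noteq> {}\<close>, of V "\<lambda>_. N"] 1 V by auto
  also have "\<dots> = PiM I (\<lambda>i. distr P N (W i))" by (intro PiM_cong eq refl)
  also have "\<dots> = distr P (PiM I (\<lambda>_. N)) (\<lambda>\<omega>. \<lambda>i\<in>I. W i \<omega>)"
    using prob_space.indep_vars_iff_distr_eq_PiM'[OF P \<open>I \<noteq> {}\<close>, of W "\<lambda>_. N"] 2 W by auto
  finally show ?thesis .
qed

lemma indep_vars_PiM_coordinates:
  assumes "\<And>i. i \<in> I \<Longrightarrow> prob_space (\<Omega> i)" and "I \<noteq> {}"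
  shows "prob_space.indep_vars (PiM I \<Omega>) \<Omega> (\<lambda>i \<omega>. \<omega> i) I"
proof -
  interpret prob_space "PiM I \<Omega>" by (rule prob_space_PiM) (use assms in auto)
  have "distr (PiM I \<Omega>) (PiM I \<Omega>) (\<lambda>\<omega>. \<lambda>i\<in>I. \<omega> i) = distr (PiM I \<Omega>) (PiM I \<Omega>) (\<lambda>\<omega>. \<omega>)"
    by (rule distr_cong) (auto simp: space_PiM PiE_restrict)
  also have "\<dots> = PiM I (\<lambda>i. distr (PiM I \<Omega>) (\<Omega> i) (\<lambda>\<omega>. \<omega> i))"
    unfolding distr_id2[OF refl] by (intro PiM_cong refl distr_PiM_component[symmetric] assms)
  finally show ?thesis
    by (subst indep_vars_iff_distr_eq_PiM'[OF \<open>I \<noteq> {}\<close>]) (auto intro: measurable_component_singleton)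
qed

section \<open>Pointwise coupling of sums over blocks\<close>

text \<open>The characteristic function of the sum is a power of the common one with exponent \<open>card J\<close>.\<close>

lemma (in prob_space) distr_sum_iid_eq:
  fixes Y :: "'i \<Rightarrow> 'a \<Rightarrow> real"
  assumes Y: "indep_vars (\<lambda>_. borel) Y I" and \<mu>: "\<And>i. i \<in> I \<Longrightarrow> distr M borel (Y i) = \<mu>"
    and J: "J \<subseteq> I" "J' \<subseteq> I" "card J = card J'"
  shows "distr M borel (\<lambda>\<omega>. \<Sum>i\<in>J. Y i \<omega>) = distr M borel (\<lambda>\<omega>. \<Sum>i\<in>J'. Y i \<omega>)"
proof (rule Levy_uniqueness)
  have [measurable]: "Y i \<in> borel_measurable M" if "i \<in> I" for i
    using Y that unfolding indep_vars_def2 by auto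
  have m: "(\<lambda>\<omega>. \<Sum>i\<in>K. Y i \<omega>) \<in> borel_measurable M" if "K \<subseteq> I" for K
    using that by (intro borel_measurable_sum) auto
  show "real_distribution (distr M borel (\<lambda>\<omega>. \<Sum>i\<in>J. Y i \<omega>))"
    "real_distribution (distr M borel (\<lambda>\<omega>. \<Sum>i\<in>J'. Y i \<omega>))"
    using m J by (auto intro!: real_distribution_distr)
  have "char (distr M borel (\<lambda>\<omega>. \<Sum>i\<in>K. Y i \<omega>)) = (\<lambda>t. char \<mu> t ^ card K)" if K: "K \<subseteq> I" for K
  proof
    fix t
    have "char (distr M borel (\<lambda>\<omega>. \<Sum>i\<in>K. Y i \<omega>)) t = (\<Prod>i\<in>K. char (distr M borel (Y i)) t)"
      by (rule char_distr_sum[OF indep_vars_subset[OF Y K]])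
    also have "\<dots> = (\<Prod>i\<in>K. char \<mu> t)" using K by (intro prod.cong) (auto simp: \<mu>)
    finally show "char (distr M borel (\<lambda>\<omega>. \<Sum>i\<in>K. Y i \<omega>)) t = char \<mu> t ^ card K" by simp
  qed
  then show "char (distr M borel (\<lambda>\<omega>. \<Sum>i\<in>J. Y i \<omega>)) = char (distr M borel (\<lambda>\<omega>. \<Sum>i\<in>J'. Y i \<omega>))"
    using J by simp
qed

text \<open>A single Skorohod representation serves all index sets \<open>J\<close>, since the law of a block sum depends
  on the length of the block only.\<close>

lemma (in prob_space) iid_sums_skorohod:
  fixes Y :: "nat \<Rightarrow> 'a \<Rightarrow> real"
  assumes Y: "indep_vars (\<lambda>_. borel) Y {1..}" and \<mu>: "\<And>i. 1 \<le> i \<Longrightarrow> distr M borel (Y i) = \<mu>"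
    and mean: "\<And>i. 1 \<le> i \<Longrightarrow> expectation (Y i) = 0"
    and sq: "\<And>i. 1 \<le> i \<Longrightarrow> integrable M (\<lambda>\<omega>. (Y i \<omega>)\<^sup>2)"
    and var: "\<And>i. 1 \<le> i \<Longrightarrow> variance (Y i) = s\<^sup>2" and s: "0 < s"
  obtains \<Omega> :: "real measure" and Z :: "nat \<Rightarrow> real \<Rightarrow> real" and G :: "real \<Rightarrow> real"
  where "prob_space \<Omega>" "\<And>k. Z k \<in> borel_measurable \<Omega>" "G \<in> borel_measurable \<Omega>"
    "distr \<Omega> borel G = std_normal_distribution"
    "\<And>x. x \<in> space \<Omega> \<Longrightarrow> (\<lambda>k. Z k x) \<longlonglongrightarrow> G x"
    "\<And>J. J \<subseteq> {1..} \<Longrightarrow>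
      distr M borel (\<lambda>\<omega>. (\<Sum>i\<in>J. Y i \<omega>) / sqrt (real (card J) * s\<^sup>2)) = distr \<Omega> borel (Z (card J))"
proof -
  have Ym: "Y i \<in> borel_measurable M" if "1 \<le> i" for i
    using Y that unfolding indep_vars_def2 by auto
  \<comment> \<open>The sequence \<open>Y\<close> is used from index 1 on, the central limit theorem sums from 0.\<close>
  define S where "S k \<omega> = (\<Sum>i<k. Y (Suc i) \<omega>) / sqrt (real k * s\<^sup>2)" for k \<omega>
  have Sm: "S k \<in> borel_measurable M" for k unfolding S_def using Ym by measurable
  have "weak_conv_m (\<lambda>k. distr M borel (S k)) std_normal_distribution"
    unfolding S_def
    by (rule central_limit_theorem_zero_mean[where X = "\<lambda>i. Y (Suc i)" and \<mu> = \<mu>])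
      (use mean sq var \<mu> s in \<open>auto intro!: indep_vars_inj_reindex[OF Y]\<close>)
  then obtain \<Omega> :: "real measure" and Z and G where \<Omega>: "prob_space \<Omega>" "\<And>k. Z k \<in> borel_measurable \<Omega>"
    "\<And>k. distr \<Omega> borel (Z k) = distr M borel (S k)" "G \<in> measurable \<Omega> lborel"
    "distr \<Omega> borel G = std_normal_distribution" "\<And>x. x \<in> space \<Omega> \<Longrightarrow> (\<lambda>k. Z k x) \<longlonglongrightarrow> G x"
    using Skorohod[of "\<lambda>k. distr M borel (S k)" std_normal_distribution]
      real_distribution_distr[OF Sm] real_dist_normal_dist by blast
  show ?thesis
  proof (rule that[OF \<Omega>(1,2) _ \<Omega>(5,6)])
    show "G \<in> borel_measurable \<Omega>" using \<Omega>(4) by simp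
    fix J :: "nat set" assume J: "J \<subseteq> {1..}"
    define T where "T K \<omega> = (\<Sum>i\<in>K. Y i \<omega>)" for K \<omega>
    have Tm: "T K \<in> borel_measurable M" if "K \<subseteq> {1..}" for K
      unfolding T_def using that Ym by (intro borel_measurable_sum) auto
    have scale: "distr M borel (\<lambda>\<omega>. T K \<omega> / a) = distr (distr M borel (T K)) borel (\<lambda>y. y / a)"
      if "K \<subseteq> {1..}" for K a
      using Tm[OF that] by (subst distr_distr) (auto simp: comp_def)
    have Sk: "S k = (\<lambda>\<omega>. T (Suc ` {..<k}) \<omega> / sqrt (real k * s\<^sup>2))" for k
      by (simp add: S_def T_def sum.reindex fun_eq_iff)
    have "distr M borel (T J) = distr M borel (T (Suc ` {..<card J}))"
      unfolding T_def by (rule distr_sum_iid_eq[OF Y, of \<mu>]) (use J \<mu> in \<open>auto simp: card_image\<close>)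
    then show "distr M borel (\<lambda>\<omega>. (\<Sum>i\<in>J. Y i \<omega>) / sqrt (real (card J) * s\<^sup>2)) = distr \<Omega> borel (Z (card J))"
      unfolding \<Omega>(3) Sk T_def[symmetric]
      using scale[OF J] scale[of "Suc ` {..<card J}"] by (simp add: image_subset_iff)
  qed
qed

text \<open>If the ratio has a positive limit, then the lengths \<open>l n\<close> tend to infinity and the values
  \<open>z (l n)\<close> converge. If it tends to 0, the lengths may stay bounded, but then boundedness of \<open>z\<close>
  suffices.\<close>

lemma tendsto_sqrt_ratio_mult:
  fixes z :: "nat \<Rightarrow> real" and l :: "nat \<Rightarrow> nat"
  assumes z: "z \<longlonglongrightarrow> g" and l: "(\<lambda>n. real (l n) / real n) \<longlonglongrightarrow> \<delta>"
  shows "(\<lambda>n. sqrt (real (l n) / real n) * z (l n)) \<longlonglongrightarrow> sqrt \<delta> * g"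
proof -
  have "0 \<le> \<delta>" by (rule LIMSEQ_le_const[OF l]) auto
  have sl: "(\<lambda>n. sqrt (real (l n) / real n)) \<longlonglongrightarrow> sqrt \<delta>" by (rule tendsto_real_sqrt[OF l])
  show ?thesis
  proof (cases "\<delta> = 0")
    case True
    have "Bseq z" by (rule convergent_imp_Bseq[OF convergentI[OF z]])
    then obtain K where "\<forall>k. norm (z k) \<le> K" unfolding Bseq_def by blast
    then have K: "\<bar>z k\<bar> \<le> K" for k by simp
    have 0: "(\<lambda>n. sqrt (real (l n) / real n) * K) \<longlonglongrightarrow> 0"
      using tendsto_mult[OF sl tendsto_const[of K]] True by simp
    have "\<forall>n. norm (sqrt (real (l n) / real n) * z (l n)) \<le> sqrt (real (l n) / real n) * K"
      by (simp add: abs_mult mult_left_mono K)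
    from Lim_null_comparison[OF always_eventually[OF this] 0]
    have "(\<lambda>n. sqrt (real (l n) / real n) * z (l n)) \<longlonglongrightarrow> 0" .
    then show ?thesis using True by simp
  next
    case False
    then have "0 < \<delta>" using \<open>0 \<le> \<delta>\<close> by simp
    have prod: "filterlim (\<lambda>n. real (l n) / real n * real n) at_top sequentially"
      by (rule filterlim_tendsto_pos_mult_at_top[OF l \<open>0 < \<delta>\<close> filterlim_real_sequentially])
    have "\<forall>\<^sub>F n in sequentially. real (l n) / real n * real n = real (l n)"
      by (rule eventually_sequentiallyI[of 1]) simp
    from filterlim_cong[OF refl refl this] prod
    have "filterlim (\<lambda>n. real (l n)) at_top sequentially" by (rule iffD1)
    then have "filterlim l sequentially sequentially"
      by (simp add: filterlim_sequentially_iff_filterlim_real)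
    from filterlim_compose[OF z this] show ?thesis by (intro tendsto_mult sl)
  qed
qed

text \<open>The blocks are \<open>(c n i, c n (i + 1)]\<close>. Each gets its own copy of the space that represents the
  central limit theorem, and \<open>W n i\<close> is the represented normalized sum of the block length rescaled
  by \<open>sqrt (length / n)\<close>. Blocks of bounded length are included: for them the limit variance
  \<open>\<tau> (i + 1) - \<tau> i\<close> is 0.\<close>

lemma (in prob_space) iid_block_sums_coupling:
  fixes Y :: "nat \<Rightarrow> 'a \<Rightarrow> real" and c :: "nat \<Rightarrow> nat \<Rightarrow> nat"
  assumes Y: "indep_vars (\<lambda>_. borel) Y {1..}" and \<mu>: "\<And>i. 1 \<le> i \<Longrightarrow> distr M borel (Y i) = \<mu>"
    and mean: "\<And>i. 1 \<le> i \<Longrightarrow> expectation (Y i) = 0"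
    and sq: "\<And>i. 1 \<le> i \<Longrightarrow> integrable M (\<lambda>\<omega>. (Y i \<omega>)\<^sup>2)"
    and var: "\<And>i. 1 \<le> i \<Longrightarrow> variance (Y i) = s\<^sup>2" and s: "0 < s"
    and r: "0 < r"
    and mono: "\<forall>\<^sub>F n in sequentially. \<forall>i<r. c n i \<le> c n (Suc i)"
    and lim: "\<And>i. i \<le> r \<Longrightarrow> (\<lambda>n. real (c n i) / real n) \<longlonglongrightarrow> \<tau> i"
  obtains P :: "(nat \<Rightarrow> real) measure" and W :: "nat \<Rightarrow> nat \<Rightarrow> (nat \<Rightarrow> real) \<Rightarrow> real"
    and G :: "nat \<Rightarrow> (nat \<Rightarrow> real) \<Rightarrow> real"
  where "prob_space P" "\<And>n i. i < r \<Longrightarrow> W n i \<in> borel_measurable P"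
    "prob_space.indep_vars P (\<lambda>_. borel) G {..<r}"
    "\<And>i. i < r \<Longrightarrow> distr P borel (G i) = std_normal_distribution"
    "\<And>i x. i < r \<Longrightarrow> x \<in> space P \<Longrightarrow> (\<lambda>n. W n i x) \<longlonglongrightarrow> sqrt (\<tau> (Suc i) - \<tau> i) * G i x"
    "\<forall>\<^sub>F n in sequentially.
       distr M (PiM {..<r} (\<lambda>_. borel))
         (\<lambda>\<omega>. \<lambda>i\<in>{..<r}. (\<Sum>k\<in>{c n i<..c n (Suc i)}. Y k \<omega>) / (s * sqrt (real n)))
       = distr P (PiM {..<r} (\<lambda>_. borel)) (\<lambda>x. \<lambda>i\<in>{..<r}. W n i x)"
proof -
  have Ym: "Y i \<in> borel_measurable M" if "1 \<le> i" for i
    using Y that unfolding indep_vars_def2 by auto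
  obtain \<Omega> :: "real measure" and Z :: "nat \<Rightarrow> real \<Rightarrow> real" and g :: "real \<Rightarrow> real"
  where \<Omega>: "prob_space \<Omega>" "\<And>k. Z k \<in> borel_measurable \<Omega>" "g \<in> borel_measurable \<Omega>"
    "distr \<Omega> borel g = std_normal_distribution"
    "\<And>x. x \<in> space \<Omega> \<Longrightarrow> (\<lambda>k. Z k x) \<longlonglongrightarrow> g x"
    "\<And>J. J \<subseteq> {1..} \<Longrightarrow>
      distr M borel (\<lambda>\<omega>. (\<Sum>i\<in>J. Y i \<omega>) / sqrt (real (card J) * s\<^sup>2)) = distr \<Omega> borel (Z (card J))"
    using iid_sums_skorohod[OF Y \<mu> mean sq var s] by blast
  define P where "P = PiM {..<r} (\<lambda>_::nat. \<Omega>)"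
  define len where "len n i = c n (Suc i) - c n i" for n i
  define w where "w n i y = sqrt (real (len n i) / real n) * Z (len n i) y" for n i y
  interpret P: prob_space P unfolding P_def by (rule prob_space_PiM) (rule \<Omega>(1))
  have coord: "(\<lambda>x. x i) \<in> measurable P \<Omega>" if "i < r" for i
    unfolding P_def using that by (intro measurable_component_singleton) auto
  have coord_distr: "distr P N (\<lambda>x. h (x i)) = distr \<Omega> N h" if "i < r" "h \<in> measurable \<Omega> N" for i h N
  proof -
    have "distr P \<Omega> (\<lambda>x. x i) = \<Omega>"
      unfolding P_def using that by (intro distr_PiM_component \<Omega>(1)) auto
    then have "distr \<Omega> N h = distr (distr P \<Omega> (\<lambda>x. x i)) N h" by simp
    also have "\<dots> = distr P N (\<lambda>x. h (x i))"
      using that coord by (subst distr_distr) (auto simp: comp_def)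
    finally show ?thesis by simp
  qed
  have coord_indep: "P.indep_vars (\<lambda>_. \<Omega>) (\<lambda>i x. x i) {..<r}"
    unfolding P_def using r by (intro indep_vars_PiM_coordinates \<Omega>(1)) auto
  have w_meas [measurable]: "w n i \<in> borel_measurable \<Omega>" for n i
    unfolding w_def using \<Omega>(2) by measurable
  show ?thesis
  proof (rule that[of P "\<lambda>n i x. w n i (x i)" "\<lambda>i x. g (x i)"])
    show "prob_space P" by (rule P.prob_space_axioms)
    show "(\<lambda>x. w n i (x i)) \<in> borel_measurable P" if "i < r" for n i
      by (rule measurable_compose[OF coord[OF that] w_meas])
    show "P.indep_vars (\<lambda>_. borel) (\<lambda>i x. g (x i)) {..<r}"
      by (rule P.indep_vars_compose2[OF coord_indep]) (rule \<Omega>(3))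
    show "distr P borel (\<lambda>x. g (x i)) = std_normal_distribution" if "i < r" for i
      using coord_distr[OF that \<Omega>(3)] \<Omega>(4) by simp
    show "(\<lambda>n. w n i (x i)) \<longlonglongrightarrow> sqrt (\<tau> (Suc i) - \<tau> i) * g (x i)" if "i < r" "x \<in> space P" for i x
    proof -
      have "x i \<in> space \<Omega>" using that by (auto simp: P_def space_PiM)
      then have z: "(\<lambda>k. Z k (x i)) \<longlonglongrightarrow> g (x i)" by (rule \<Omega>(5))
      have "(\<lambda>n. real (c n (Suc i)) / real n - real (c n i) / real n) \<longlonglongrightarrow> \<tau> (Suc i) - \<tau> i"
        using that by (intro tendsto_diff lim) auto
      then have "(\<lambda>n. real (len n i) / real n) \<longlonglongrightarrow> \<tau> (Suc i) - \<tau> i"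
        by (rule Lim_transform_eventually)
          (use mono in \<open>eventually_elim, use that(1) in \<open>auto simp: len_def diff_divide_distrib\<close>\<close>)
      from tendsto_sqrt_ratio_mult[OF z this] show ?thesis by (simp add: w_def)
    qed
    have "distr M (PiM {..<r} (\<lambda>_. borel))
        (\<lambda>\<omega>. \<lambda>i\<in>{..<r}. (\<Sum>k\<in>{c n i<..c n (Suc i)}. Y k \<omega>) / (s * sqrt (real n)))
      = distr P (PiM {..<r} (\<lambda>_. borel)) (\<lambda>x. \<lambda>i\<in>{..<r}. w n i (x i))"
      if n: "0 < n" "\<forall>i<r. c n i \<le> c n (Suc i)" for n
    proof (rule distr_indep_vars_eq[OF prob_space_axioms P.prob_space_axioms])
      let ?K = "\<lambda>i. {c n i<..c n (Suc i)}"
      have cmono: "c n i \<le> c n j" if "i \<le> j" "j \<le> r" for i j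
        using that n(2) by (induction j rule: dec_induct) (auto intro: order_trans)
      have disj: "?K i \<inter> ?K j = {}" if "i < j" "j < r" for i j
        using cmono[of "Suc i" j] that by auto
      have "disjoint_family_on ?K {..<r}"
        unfolding disjoint_family_on_def using disj by (metis Int_commute lessThan_iff nat_neq_iff)
      then have "indep_vars (\<lambda>i. PiM (?K i) (\<lambda>_. borel)) (\<lambda>i \<omega>. restrict (\<lambda>k. Y k \<omega>) (?K i)) {..<r}"
        by (intro indep_vars_restrict[OF Y]) auto
      from indep_vars_compose2[OF this, of "\<lambda>i f. (\<Sum>k\<in>?K i. f k) / (s * sqrt (real n))" "\<lambda>_. borel"]
      show "indep_vars (\<lambda>_. borel) (\<lambda>i \<omega>. (\<Sum>k\<in>?K i. Y k \<omega>) / (s * sqrt (real n))) {..<r}"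
        by simp
      show "P.indep_vars (\<lambda>_. borel) (\<lambda>i x. w n i (x i)) {..<r}"
        by (rule P.indep_vars_compose2[OF coord_indep]) (rule w_meas)
      show "{..<r} \<noteq> {}" using r by auto
      fix i assume "i \<in> {..<r}"
      then have i: "i < r" by simp
      have K: "card (?K i) = len n i" "?K i \<subseteq> {1..}" by (auto simp: len_def)
      let ?q = "sqrt (real (len n i) / real n)"
      define T where "T \<omega> = (\<Sum>k\<in>?K i. Y k \<omega>) / sqrt (real (len n i) * s\<^sup>2)" for \<omega>
      have Tm: "T \<in> borel_measurable M"
        unfolding T_def using K(2) Ym by (intro borel_measurable_divide borel_measurable_sum) auto
      have VT: "(\<Sum>k\<in>?K i. Y k \<omega>) / (s * sqrt (real n)) = ?q * T \<omega>" for \<omega>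
      proof (cases "len n i = 0")
        case True
        then have "?K i = {}" by (simp add: len_def)
        then show ?thesis using True by simp
      next
        case False
        then show ?thesis using s by (simp add: T_def real_sqrt_mult real_sqrt_divide)
      qed
      have "distr M borel (\<lambda>\<omega>. ?q * T \<omega>) = distr (distr M borel T) borel (\<lambda>y. ?q * y)"
        using Tm by (subst distr_distr) (auto simp: comp_def)
      also have "\<dots> = distr (distr \<Omega> borel (Z (len n i))) borel (\<lambda>y. ?q * y)"
        using \<Omega>(6)[OF K(2)] unfolding K(1) T_def by simp
      also have "\<dots> = distr \<Omega> borel (w n i)"
        using \<Omega>(2) by (subst distr_distr) (auto simp: comp_def w_def[abs_def])
      finally show "distr M borel (\<lambda>\<omega>. (\<Sum>k\<in>?K i. Y k \<omega>) / (s * sqrt (real n))) = distr P borel (\<lambda>x. w n i (x i))"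
        unfolding VT coord_distr[OF i w_meas] .
    qed
    from eventually_mono[OF eventually_conj[OF eventually_gt_at_top[of 0] mono] this]
    show "\<forall>\<^sub>F n in sequentially. distr M (PiM {..<r} (\<lambda>_. borel))
        (\<lambda>\<omega>. \<lambda>i\<in>{..<r}. (\<Sum>k\<in>{c n i<..c n (Suc i)}. Y k \<omega>) / (s * sqrt (real n)))
      = distr P (PiM {..<r} (\<lambda>_. borel)) (\<lambda>x. \<lambda>i\<in>{..<r}. w n i (x i))"
      by simp
  qed
qed

text \<open>The definition of Brownian motion speaks of increments along strictly increasing sequences of
  times, and sums of increments from time 0 require 0 to be one of the times. The given finite set of
  times is therefore embedded in such a sequence; after its last element the sequence increases by
  unit steps.\<close>

lemma finite_set_in_strict_mono_range:
  fixes S :: "real set"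
  assumes S: "finite S" "\<And>x. x \<in> S \<Longrightarrow> 0 \<le> x"
  obtains s :: "nat \<Rightarrow> real" where "strict_mono s" "s 0 = 0" "S \<subseteq> range s"
proof -
  define l where "l = sorted_list_of_set (insert 0 S)"
  define L where "L = length l"
  have l: "set l = insert 0 S" "sorted_wrt (<) l" using S by (simp_all only: l_def set_sorted_list_of_set strict_sorted_list_of_set finite_insert)
  then have L: "0 < L" by (auto simp: L_def)
  define s where "s i = (if i < L then l ! i else l ! (L - 1) + real (Suc i - L))" for i
  have "s i < s (Suc i)" for i
  proof -
    consider "Suc i < L" | "Suc i = L" | "L \<le> i" by linarith
    then show ?thesis
    proof cases
      case 1
      then show ?thesis using sorted_wrt_nth_less[OF l(2), of i "Suc i"] by (simp add: s_def L_def)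
    next
      case 2
      then have "L - 1 = i" by simp
      then show ?thesis using 2 by (simp add: s_def)
    next
      case 3
      then show ?thesis by (simp add: s_def Suc_diff_le)
    qed
  qed
  then have 1: "strict_mono s" by (simp add: strict_mono_Suc_iff)
  have range: "insert 0 S \<subseteq> range s"
  proof
    fix x assume "x \<in> insert 0 S"
    then obtain i where "i < L" "x = l ! i" unfolding l(1)[symmetric] L_def in_set_conv_nth by blast
    then show "x \<in> range s" by (auto simp: s_def intro!: image_eqI[of _ _ i])
  qed
  have "s 0 = l ! 0" using L by (simp add: s_def)
  then have "s 0 \<in> insert 0 S" using L nth_mem[of 0 l] l(1) by (simp add: L_def)
  then have "0 \<le> s 0" using S by auto
  moreover obtain i where "s i = 0" using range by auto
  moreover have "s 0 \<le> s i" using 1 by (simp add: strict_mono_less_eq)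
  ultimately show ?thesis using that[OF 1] range by auto
qed

lemma vec_lambda_measurable:
  fixes f :: "'k::finite \<Rightarrow> 'a \<Rightarrow> real"
  assumes "\<And>i. f i \<in> borel_measurable M"
  shows "(\<lambda>x. \<chi> i. f i x) \<in> borel_measurable M"
proof (subst borel_measurable_euclidean_space, intro ballI)
  fix e :: "real ^ 'k" assume "e \<in> Basis"
  then obtain i where "e = axis i 1" by (auto simp: Basis_vec_def)
  then show "(\<lambda>x. (\<chi> i. f i x) \<bullet> e) \<in> borel_measurable M"
    using assms[of i] by (simp add: inner_axis)
qed

section \<open>Finite-dimensional distributions of the interpolated walk\<close>

definition interpolated_walk :: "(nat \<Rightarrow> 'w \<Rightarrow> real) \<Rightarrow> real \<Rightarrow> nat \<Rightarrow> real \<Rightarrow> 'w \<Rightarrow> real" where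
  "interpolated_walk Y s n t \<omega> =
     ((\<Sum>k\<in>{0<..nat \<lfloor>real n * t\<rfloor>}. Y k \<omega>)
        + (real n * t - real (nat \<lfloor>real n * t\<rfloor>)) * Y (nat \<lfloor>real n * t\<rfloor> + 1) \<omega>) / (s * sqrt (real n))"

lemma sum_consecutive_blocks:
  fixes y :: "nat \<Rightarrow> real"
  assumes "c 0 = 0" "\<forall>i<q. c i \<le> c (Suc i)"
  shows "(\<Sum>i<q. \<Sum>k\<in>{c i<..c (Suc i)}. y k) = (\<Sum>k\<in>{0<..c q}. y k)"
  using assms(2)
proof (induction q)
  case (Suc q)
  have "{0<..c (Suc q)} = {0<..c q} \<union> {c q<..c (Suc q)}" using Suc.prems by auto
  then have "(\<Sum>k\<in>{0<..c (Suc q)}. y k) = (\<Sum>k\<in>{0<..c q}. y k) + (\<Sum>k\<in>{c q<..c (Suc q)}. y k)"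
    by (simp add: sum.union_disjoint)
  then show ?case using Suc by simp
qed (simp add: assms(1))

lemma nat_floor_bounds:
  assumes "0 \<le> x"
  shows "real (nat \<lfloor>x\<rfloor>) \<le> x" "x < real (nat \<lfloor>x\<rfloor>) + 1"
  using assms by (auto simp: of_nat_nat)

lemma brownian_increments_law:
  fixes tt :: "nat \<Rightarrow> real"
  assumes b: "standard_brownian_motion N b" and tt: "strict_mono tt" "0 \<le> tt 0" and m: "0 < m"
    and P: "prob_space P" and G: "prob_space.indep_vars P (\<lambda>_. borel) G {..<m}"
    and G_law: "\<And>a. a < m \<Longrightarrow> distr P borel (G a) = std_normal_distribution"
  shows "distr N (PiM {..<m} (\<lambda>_. borel)) (\<lambda>\<omega>. \<lambda>a\<in>{..<m}. b (tt (Suc a)) \<omega> - b (tt a) \<omega>)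
    = distr P (PiM {..<m} (\<lambda>_. borel)) (\<lambda>x. \<lambda>a\<in>{..<m}. sqrt (tt (Suc a) - tt a) * G a x)"
proof (rule distr_indep_vars_eq)
  interpret P: prob_space P by (rule P)
  show "prob_space N" "prob_space P" using b P by (auto simp: standard_brownian_motion_def)
  show "{..<m} \<noteq> {}" using m by auto
  show "prob_space.indep_vars N (\<lambda>_. borel) (\<lambda>a \<omega>. b (tt (Suc a)) \<omega> - b (tt a) \<omega>) {..<m}"
    using b tt by (auto simp: standard_brownian_motion_def)
  show "P.indep_vars (\<lambda>_. borel) (\<lambda>a x. sqrt (tt (Suc a) - tt a) * G a x) {..<m}"
    by (rule P.indep_vars_compose2[OF G]) simp
  fix a assume "a \<in> {..<m}"
  then have a: "a < m" by simp
  let ?\<delta> = "tt (Suc a) - tt a"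
  have lt: "tt a < tt (Suc a)" using tt(1) by (simp add: strict_mono_less)
  have "0 \<le> tt a" using tt by (metis order_trans strict_mono_less_eq zero_le)
  then have "distributed N lborel (\<lambda>\<omega>. b (tt (Suc a)) \<omega> - b (tt a) \<omega>) (normal_density 0 (sqrt ?\<delta>))"
    using b lt unfolding standard_brownian_motion_def by blast
  then have "distr N lborel (\<lambda>\<omega>. b (tt (Suc a)) \<omega> - b (tt a) \<omega>) = density lborel (normal_density 0 (sqrt ?\<delta>))"
    by (rule distributed_distr_eq_density)
  moreover have "G a \<in> borel_measurable P"
    using G a unfolding P.indep_vars_def2 by auto
  then have "distributed P lborel (G a) std_normal_density"
    using G_law[OF a] by (auto simp: distributed_def cong: distr_cong)
  from P.normal_density_affine[OF this, of "sqrt ?\<delta>" 0] lt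
  have "distributed P lborel (\<lambda>x. sqrt ?\<delta> * G a x) (normal_density 0 (sqrt ?\<delta>))" by simp
  then have "distr P lborel (\<lambda>x. sqrt ?\<delta> * G a x) = density lborel (normal_density 0 (sqrt ?\<delta>))"
    by (rule distributed_distr_eq_density)
  moreover have "distr K lborel h = distr K borel h" for K :: "'z measure" and h
    by (rule distr_cong) auto
  moreover have "distr K lborel h = distr K borel h" for K :: "'y measure" and h
    by (rule distr_cong) auto
  ultimately show "distr N borel (\<lambda>\<omega>. b (tt (Suc a)) \<omega> - b (tt a) \<omega>) = distr P borel (\<lambda>x. sqrt ?\<delta> * G a x)"
    by (metis distr_cong sets_lborel)
qed

text \<open>The cut points are \<open>\<lfloor>n t\<^sub>j\<rfloor>\<close> and \<open>\<lfloor>n t\<^sub>j\<rfloor> + 1\<close>, with even and odd indices respectively. An even block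
  is thus the single summand that is interpolated after time \<open>t\<^sub>j\<close>, and an odd block fills the gap
  up to time \<open>t\<^sub>j\<^sub>+\<^sub>1\<close>. For large \<open>n\<close> the cut points are ordered, because the times are distinct. Splitting
  off the interpolated summands makes the walk at all times a linear function of independent variables.\<close>

theorem (in prob_space) interpolated_walk_fdd_tendsto:
  fixes Y :: "nat \<Rightarrow> 'a \<Rightarrow> real" and t :: "'k::finite \<Rightarrow> real" and f :: "real ^ 'k \<Rightarrow> real"
  assumes Y: "indep_vars (\<lambda>_. borel) Y {1..}" and \<mu>: "\<And>i. 1 \<le> i \<Longrightarrow> distr M borel (Y i) = \<mu>"
    and mean: "\<And>i. 1 \<le> i \<Longrightarrow> expectation (Y i) = 0"
    and sq: "\<And>i. 1 \<le> i \<Longrightarrow> integrable M (\<lambda>\<omega>. (Y i \<omega>)\<^sup>2)"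
    and var: "\<And>i. 1 \<le> i \<Longrightarrow> variance (Y i) = s\<^sup>2" and s: "0 < s"
    and b: "standard_brownian_motion N b" and t: "\<And>i. 0 \<le> t i"
    and f: "continuous_on UNIV f" "bounded (range f)"
  shows "(\<lambda>n. \<integral>\<omega>. f (\<chi> i. interpolated_walk Y s n (t i) \<omega>) \<partial>M) \<longlonglongrightarrow> (\<integral>\<omega>. f (\<chi> i. b (t i) \<omega>) \<partial>N)"
proof -
  have N: "prob_space N" using b by (simp add: standard_brownian_motion_def)
  have bm: "b x \<in> borel_measurable N" if "0 \<le> x" for x
    using b that by (simp add: standard_brownian_motion_def)
  have fm: "f \<in> borel_measurable borel" by (rule borel_measurable_continuous_onI[OF f(1)])
  obtain F where F: "\<And>x. \<bar>f x\<bar> \<le> F" using f(2) by (auto simp: bounded_iff)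
  obtain tt :: "nat \<Rightarrow> real" where tt: "strict_mono tt" "tt 0 = 0" "range t \<subseteq> range tt"
    using finite_set_in_strict_mono_range[of "range t"] t by auto
  then have "\<forall>i. \<exists>j. tt j = t i" by (metis imageE range_subsetD)
  then obtain \<rho> where \<rho>: "\<And>i. tt (\<rho> i) = t i" by metis
  define m where "m = Suc (Max (range \<rho>))"
  have \<rho>m: "\<rho> i < m" for i by (simp add: m_def less_Suc_eq_le)
  have tt0: "0 \<le> tt j" for j using tt(1,2) by (metis strict_mono_less_eq zero_le)
  define K where "K n j = nat \<lfloor>real n * tt j\<rfloor>" for n j
  define \<theta> where "\<theta> n j = real n * tt j - real (K n j)" for n j
  define c where "c n i = K n (i div 2) + i mod 2" for n i
  have K: "real (K n j) \<le> real n * tt j" "real n * tt j < real (K n j) + 1" for n j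
    unfolding K_def using tt0 by (intro nat_floor_bounds; simp)+
  have \<theta>: "\<bar>\<theta> n j\<bar> \<le> 1" for n j using K(1)[of n j] K(2)[of n j] by (simp add: \<theta>_def)
  have c_even: "c n (2 * j) = K n j" and c_odd: "c n (Suc (2 * j)) = Suc (K n j)" for n j
    by (auto simp: c_def)
  have c0: "c n 0 = 0" for n by (simp add: c_def K_def tt(2))
  have c_mono: "\<forall>\<^sub>F n in sequentially. \<forall>i<2 * m. c n i \<le> c n (Suc i)"
  proof -
    have "\<forall>\<^sub>F n in sequentially. \<forall>j\<in>{..<m}. 1 \<le> real n * (tt (Suc j) - tt j)"
    proof (intro eventually_ball_finite ballI)
      fix j
      have "0 < tt (Suc j) - tt j" using tt(1) by (simp add: strict_mono_less)
      then have "filterlim (\<lambda>n. real n * (tt (Suc j) - tt j)) at_top sequentially"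
        by (intro filterlim_at_top_mult_tendsto_pos[OF tendsto_const] filterlim_real_sequentially)
      then show "\<forall>\<^sub>F n in sequentially. 1 \<le> real n * (tt (Suc j) - tt j)"
        by (simp add: filterlim_at_top)
    qed simp
    then show ?thesis
    proof (rule eventually_mono, intro allI impI)
      fix n i assume *: "\<forall>j\<in>{..<m}. 1 \<le> real n * (tt (Suc j) - tt j)" and i: "i < 2 * m"
      show "c n i \<le> c n (Suc i)"
      proof (cases "even i")
        case True
        then obtain j where "i = 2 * j" by (elim evenE)
        then show ?thesis by (simp add: c_even c_odd)
      next
        case False
        then obtain j where j: "i = Suc (2 * j)" by (auto elim: oddE)
        then have "1 \<le> real n * (tt (Suc j) - tt j)" using * i by auto
        then have "real (K n j) + 1 < real (K n (Suc j)) + 1"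
          using K(1)[of n j] K(2)[of n "Suc j"] by (simp add: algebra_simps)
        then have "Suc (K n j) \<le> K n (Suc j)" by linarith
        moreover have "Suc i = 2 * Suc j" using j by simp
        ultimately show ?thesis using j c_odd c_even by metis
      qed
    qed
  qed
  have c_lim: "(\<lambda>n. real (c n i) / real n) \<longlonglongrightarrow> tt (i div 2)" for i
  proof -
    have "(\<lambda>n. real (c n i) / real n - tt (i div 2)) \<longlonglongrightarrow> 0"
    proof (rule Lim_null_comparison)
      show "(\<lambda>n. 1 / real n) \<longlonglongrightarrow> 0" by (rule lim_1_over_n)
      show "\<forall>\<^sub>F n in sequentially. norm (real (c n i) / real n - tt (i div 2)) \<le> 1 / real n"
      proof (rule eventually_sequentiallyI[of 1])
        fix n :: nat assume n: "1 \<le> n"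
        have "real (c n i) / real n - tt (i div 2) = (real (c n i) - real n * tt (i div 2)) / real n"
          using n by (simp add: diff_divide_distrib)
        moreover have "\<bar>real (c n i) - real n * tt (i div 2)\<bar> \<le> 1"
        proof -
          have "i mod 2 = 0 \<or> i mod 2 = 1" by linarith
          then show ?thesis using K(1)[of n "i div 2"] K(2)[of n "i div 2"] by (auto simp: c_def)
        qed
        ultimately show "norm (real (c n i) / real n - tt (i div 2)) \<le> 1 / real n"
          by (simp add: abs_divide divide_right_mono)
      qed
    qed
    then show ?thesis by (simp add: LIM_zero_iff)
  qed
  have r: "0 < 2 * m" by (simp add: m_def)
  obtain P :: "(nat \<Rightarrow> real) measure" and W G
  where P: "prob_space P" and W: "\<And>n i. i < 2 * m \<Longrightarrow> W n i \<in> borel_measurable P"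
    and G: "prob_space.indep_vars P (\<lambda>_. borel) G {..<2 * m}"
      "\<And>i. i < 2 * m \<Longrightarrow> distr P borel (G i) = std_normal_distribution"
    and WG: "\<And>i x. i < 2 * m \<Longrightarrow> x \<in> space P \<Longrightarrow>
       (\<lambda>n. W n i x) \<longlonglongrightarrow> sqrt (tt (Suc i div 2) - tt (i div 2)) * G i x"
    and law: "\<forall>\<^sub>F n in sequentially.
       distr M (PiM {..<2 * m} (\<lambda>_. borel))
         (\<lambda>\<omega>. \<lambda>i\<in>{..<2 * m}. (\<Sum>k\<in>{c n i<..c n (Suc i)}. Y k \<omega>) / (s * sqrt (real n)))
       = distr P (PiM {..<2 * m} (\<lambda>_. borel)) (\<lambda>x. \<lambda>i\<in>{..<2 * m}. W n i x)"
    using iid_block_sums_coupling[OF Y \<mu> mean sq var s r c_mono c_lim] by blast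
  interpret P: prob_space P by (rule P)
  interpret N: prob_space N by (rule N)
  have Ym: "Y i \<in> borel_measurable M" if "1 \<le> i" for i
    using Y that unfolding indep_vars_def2 by auto
  have Gm: "G i \<in> borel_measurable P" if "i < 2 * m" for i
    using G(1) that unfolding P.indep_vars_def2 by auto
  define V where "V n i \<omega> = (\<Sum>k\<in>{c n i<..c n (Suc i)}. Y k \<omega>) / (s * sqrt (real n))" for n i \<omega>
  define \<Psi> where "\<Psi> n x = f (\<chi> i. (\<Sum>l<2 * \<rho> i. x l) + \<theta> n (\<rho> i) * x (2 * \<rho> i))" for n and x :: "nat \<Rightarrow> real"
  define \<Phi> where "\<Phi> x = f (\<chi> i. \<Sum>a<\<rho> i. x a)" for x :: "nat \<Rightarrow> real"
  have \<rho>2: "l < 2 * m" if "l \<le> 2 * \<rho> i" for l i using that \<rho>m[of i] by linarith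
  have \<Psi>m: "\<Psi> n \<in> borel_measurable (PiM {..<2 * m} (\<lambda>_. borel))" for n
    unfolding \<Psi>_def
    by (intro measurable_compose[OF _ fm] vec_lambda_measurable borel_measurable_add borel_measurable_sum
        borel_measurable_times borel_measurable_const measurable_component_singleton)
      (auto intro: \<rho>2[OF less_imp_le] \<rho>m)
  have \<Phi>m: "\<Phi> \<in> borel_measurable (PiM {..<m} (\<lambda>_. borel))"
    unfolding \<Phi>_def
    by (intro measurable_compose[OF _ fm] vec_lambda_measurable borel_measurable_sum
        measurable_component_singleton) (use \<rho>m order_less_trans in auto)
  have Vm: "(\<lambda>\<omega>. \<lambda>i\<in>{..<2 * m}. V n i \<omega>) \<in> measurable M (PiM {..<2 * m} (\<lambda>_. borel))" for n
    unfolding V_def by (intro measurable_restrict borel_measurable_divide borel_measurable_sum Ym) auto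
  have Wm: "(\<lambda>x. \<lambda>i\<in>{..<2 * m}. W n i x) \<in> measurable P (PiM {..<2 * m} (\<lambda>_. borel))" for n
    by (intro measurable_restrict W) auto
  have path: "f (\<chi> i. interpolated_walk Y s n (t i) \<omega>) = \<Psi> n (\<lambda>i\<in>{..<2 * m}. V n i \<omega>)"
    if n: "\<forall>i<2 * m. c n i \<le> c n (Suc i)" for n \<omega>
  proof -
    have "interpolated_walk Y s n (t i) \<omega> = (\<Sum>l<2 * \<rho> i. V n l \<omega>) + \<theta> n (\<rho> i) * V n (2 * \<rho> i) \<omega>" for i
    proof -
      have "(\<Sum>l<2 * \<rho> i. V n l \<omega>) = (\<Sum>l<2 * \<rho> i. \<Sum>k\<in>{c n l<..c n (Suc l)}. Y k \<omega>) / (s * sqrt (real n))"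
        by (simp add: V_def sum_divide_distrib)
      also have "(\<Sum>l<2 * \<rho> i. \<Sum>k\<in>{c n l<..c n (Suc l)}. Y k \<omega>) = (\<Sum>k\<in>{0<..K n (\<rho> i)}. Y k \<omega>)"
        using sum_consecutive_blocks[of "c n" "2 * \<rho> i" "\<lambda>k. Y k \<omega>"] c0 n \<rho>2[of _ i]
        by (simp add: c_even)
      finally have 1: "(\<Sum>l<2 * \<rho> i. V n l \<omega>) = (\<Sum>k\<in>{0<..K n (\<rho> i)}. Y k \<omega>) / (s * sqrt (real n))" .
      have "{K n (\<rho> i)<..Suc (K n (\<rho> i))} = {Suc (K n (\<rho> i))}" by auto
      then have 2: "V n (2 * \<rho> i) \<omega> = Y (Suc (K n (\<rho> i))) \<omega> / (s * sqrt (real n))"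
        by (simp add: V_def c_even c_odd)
      show ?thesis
        unfolding 1 2 interpolated_walk_def \<rho>[symmetric] K_def[symmetric] \<theta>_def
        by (simp add: add_divide_distrib)
    qed
    moreover have "(\<Sum>l<2 * \<rho> i. (\<lambda>i\<in>{..<2 * m}. V n i \<omega>) l) = (\<Sum>l<2 * \<rho> i. V n l \<omega>)" for i
      by (intro sum.cong) (use \<rho>2[of _ i] in auto)
    ultimately show ?thesis using \<rho>m by (simp add: \<Psi>_def)
  qed
  have transfer: "\<forall>\<^sub>F n in sequentially. (\<integral>x. \<Psi> n (\<lambda>i\<in>{..<2 * m}. W n i x) \<partial>P)
      = (\<integral>\<omega>. f (\<chi> i. interpolated_walk Y s n (t i) \<omega>) \<partial>M)"
    using law c_mono
  proof eventually_elim
    case (elim n)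
    have "(\<integral>x. \<Psi> n (\<lambda>i\<in>{..<2 * m}. W n i x) \<partial>P)
        = (\<integral>y. \<Psi> n y \<partial>distr P (PiM {..<2 * m} (\<lambda>_. borel)) (\<lambda>x. \<lambda>i\<in>{..<2 * m}. W n i x))"
      by (rule integral_distr[OF Wm \<Psi>m, symmetric])
    also have "\<dots> = (\<integral>y. \<Psi> n y \<partial>distr M (PiM {..<2 * m} (\<lambda>_. borel)) (\<lambda>\<omega>. \<lambda>i\<in>{..<2 * m}. V n i \<omega>))"
      using elim(1) by (simp add: V_def)
    also have "\<dots> = (\<integral>\<omega>. \<Psi> n (\<lambda>i\<in>{..<2 * m}. V n i \<omega>) \<partial>M)"
      by (rule integral_distr[OF Vm \<Psi>m])
    finally show ?case unfolding path[OF elim(2)] .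
  qed
  \<comment> \<open>Even blocks have limit variance 0, so only the Gaussian variables of odd index survive.\<close>
  define D where "D a x = sqrt (tt (Suc a) - tt a) * G (Suc (2 * a)) x" for a x
  have even_odd: "(\<Sum>l<2 * q. sqrt (tt (Suc l div 2) - tt (l div 2)) * G l x) = (\<Sum>a<q. D a x)" for q x
    by (induction q) (auto simp: D_def)
  have Dm: "D a \<in> borel_measurable P" if "a < m" for a
    unfolding D_def using that by (intro borel_measurable_times borel_measurable_const Gm) auto
  have "(\<lambda>n. \<integral>x. \<Psi> n (\<lambda>i\<in>{..<2 * m}. W n i x) \<partial>P) \<longlonglongrightarrow> (\<integral>x. \<Phi> (\<lambda>a\<in>{..<m}. D a x) \<partial>P)"
  proof (rule integral_dominated_convergence)
    show "(\<lambda>x. \<Phi> (\<lambda>a\<in>{..<m}. D a x)) \<in> borel_measurable P"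
      by (rule measurable_compose[OF measurable_restrict \<Phi>m]) (use Dm in auto)
    show "(\<lambda>x. \<Psi> n (\<lambda>i\<in>{..<2 * m}. W n i x)) \<in> borel_measurable P" for n
      by (rule measurable_compose[OF Wm \<Psi>m])
    show "integrable P (\<lambda>_. F)" by simp
    show "AE x in P. norm (\<Psi> n (\<lambda>i\<in>{..<2 * m}. W n i x)) \<le> F" for n
      using F by (simp add: \<Psi>_def)
    show "AE x in P. (\<lambda>n. \<Psi> n (\<lambda>i\<in>{..<2 * m}. W n i x)) \<longlonglongrightarrow> \<Phi> (\<lambda>a\<in>{..<m}. D a x)"
    proof (rule AE_I2)
      fix x assume x: "x \<in> space P"
      have "(\<lambda>n. (\<Sum>l<2 * \<rho> i. W n l x) + \<theta> n (\<rho> i) * W n (2 * \<rho> i) x) \<longlonglongrightarrow> (\<Sum>a<\<rho> i. D a x)" for i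
      proof -
        have "(\<lambda>n. W n (2 * \<rho> i) x) \<longlonglongrightarrow> 0"
          using WG[OF \<rho>2[of "2 * \<rho> i" i] x] by simp
        then have W0: "(\<lambda>n. \<bar>W n (2 * \<rho> i) x\<bar>) \<longlonglongrightarrow> 0" by (simp add: tendsto_rabs_zero)
        have "(\<lambda>n. \<theta> n (\<rho> i) * W n (2 * \<rho> i) x) \<longlonglongrightarrow> 0"
          by (rule Lim_null_comparison[OF _ W0])
            (auto simp: abs_mult intro!: always_eventually mult_left_le_one_le \<theta>)
        moreover have "(\<lambda>n. \<Sum>l<2 * \<rho> i. W n l x) \<longlonglongrightarrow> (\<Sum>a<\<rho> i. D a x)"
          unfolding even_odd[symmetric] by (intro tendsto_sum WG x) (use \<rho>2[of _ i] in auto)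
        ultimately show ?thesis using tendsto_add by fastforce
      qed
      then have "(\<lambda>n. \<chi> i. (\<Sum>l<2 * \<rho> i. W n l x) + \<theta> n (\<rho> i) * W n (2 * \<rho> i) x) \<longlonglongrightarrow> (\<chi> i. \<Sum>a<\<rho> i. D a x)"
        by (intro tendsto_vec_lambda)
      then have "(\<lambda>n. f (\<chi> i. (\<Sum>l<2 * \<rho> i. W n l x) + \<theta> n (\<rho> i) * W n (2 * \<rho> i) x)) \<longlonglongrightarrow> f (\<chi> i. \<Sum>a<\<rho> i. D a x)"
        by (rule continuous_on_tendsto_compose[OF f(1)]) auto
      moreover have "(\<Sum>l<2 * \<rho> i. (\<lambda>i\<in>{..<2 * m}. W n i x) l) = (\<Sum>l<2 * \<rho> i. W n l x)" for i n
        by (intro sum.cong) (use \<rho>2[of _ i] in auto)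
      moreover have "(\<Sum>a<\<rho> i. (\<lambda>a\<in>{..<m}. D a x) a) = (\<Sum>a<\<rho> i. D a x)" for i
        by (intro sum.cong) (use \<rho>m[of i] in auto)
      ultimately show "(\<lambda>n. \<Psi> n (\<lambda>i\<in>{..<2 * m}. W n i x)) \<longlonglongrightarrow> \<Phi> (\<lambda>a\<in>{..<m}. D a x)"
        using \<rho>m by (simp add: \<Psi>_def \<Phi>_def)
    qed
  qed
  moreover have "(\<integral>x. \<Phi> (\<lambda>a\<in>{..<m}. D a x) \<partial>P) = (\<integral>\<omega>. f (\<chi> i. b (t i) \<omega>) \<partial>N)"
  proof -
    define B where "B a \<omega> = b (tt (Suc a)) \<omega> - b (tt a) \<omega>" for a \<omega>
    have Bm: "(\<lambda>\<omega>. \<lambda>a\<in>{..<m}. B a \<omega>) \<in> measurable N (PiM {..<m} (\<lambda>_. borel))"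
      unfolding B_def by (intro measurable_restrict borel_measurable_diff bm tt0)
    have odd_indep: "P.indep_vars (\<lambda>_. borel) (\<lambda>a. G (Suc (2 * a))) {..<m}"
      by (rule P.indep_vars_inj_reindex[OF G(1)]) (auto simp: inj_on_def)
    have "(\<integral>x. \<Phi> (\<lambda>a\<in>{..<m}. D a x) \<partial>P)
        = (\<integral>y. \<Phi> y \<partial>distr P (PiM {..<m} (\<lambda>_. borel)) (\<lambda>x. \<lambda>a\<in>{..<m}. D a x))"
      by (rule integral_distr[OF measurable_restrict \<Phi>m, symmetric]) (use Dm in auto)
    also have "\<dots> = (\<integral>y. \<Phi> y \<partial>distr N (PiM {..<m} (\<lambda>_. borel)) (\<lambda>\<omega>. \<lambda>a\<in>{..<m}. B a \<omega>))"
      using brownian_increments_law[OF b tt(1) _ _ P odd_indep G(2)] tt(2) \<rho>m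
      unfolding D_def B_def by (simp add: m_def)
    also have "\<dots> = (\<integral>\<omega>. \<Phi> (\<lambda>a\<in>{..<m}. B a \<omega>) \<partial>N)"
      by (rule integral_distr[OF Bm \<Phi>m])
    also have "\<dots> = (\<integral>\<omega>. f (\<chi> i. b (t i) \<omega>) \<partial>N)"
    proof (rule integral_cong_AE)
      show "(\<lambda>\<omega>. \<Phi> (\<lambda>a\<in>{..<m}. B a \<omega>)) \<in> borel_measurable N"
        by (rule measurable_compose[OF Bm \<Phi>m])
      show "(\<lambda>\<omega>. f (\<chi> i. b (t i) \<omega>)) \<in> borel_measurable N"
        by (intro measurable_compose[OF _ fm] vec_lambda_measurable bm t)
      have "AE \<omega> in N. b 0 \<omega> = 0" using b by (simp add: standard_brownian_motion_def)
      then show "AE \<omega> in N. \<Phi> (\<lambda>a\<in>{..<m}. B a \<omega>) = f (\<chi> i. b (t i) \<omega>)"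
      proof eventually_elim
        case (elim \<omega>)
        have "(\<Sum>a<q. B a \<omega>) = b (tt q) \<omega>" for q
          using sum_lessThan_telescope[of "\<lambda>a. b (tt a) \<omega>" q] elim by (simp add: B_def tt(2))
        moreover have "(\<Sum>a<\<rho> i. (\<lambda>a\<in>{..<m}. B a \<omega>) a) = (\<Sum>a<\<rho> i. B a \<omega>)" for i
          by (intro sum.cong) (use \<rho>m[of i] in auto)
        ultimately show ?case by (simp add: \<Phi>_def \<rho>)
      qed
    qed
    finally show ?thesis .
  qed
  ultimately have "(\<lambda>n. \<integral>x. \<Psi> n (\<lambda>i\<in>{..<2 * m}. W n i x) \<partial>P) \<longlonglongrightarrow> (\<integral>\<omega>. f (\<chi> i. b (t i) \<omega>) \<partial>N)" by simp
  then show ?thesis by (rule Lim_transform_eventually[OF _ transfer])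
qed

section \<open>The fuzzy random walk\<close>

theorem theorem2p2:
  fixes M :: "'w measure"
    and X :: "nat \<Rightarrow> 'w \<Rightarrow> (real ^ 'd) fuzzy"
    and m :: "(real ^ 'd) fuzzy"
    and p \<sigma> \<alpha> \<sigma>' :: real
    and u :: "real ^ 'd"
    and j :: nat
    and N :: "'v measure"
    and b :: "real \<Rightarrow> 'v \<Rightarrow> real"
    and t :: "'k::{finite,linorder} \<Rightarrow> real"
  assumes "CARD('d) > 1"
    and "1 \<le> p"
    and "prob_space M"
    and "\<forall>i\<ge>1. fuzzy_random_variable p M (X i)"
    and "prob_space.indep_vars M (\<lambda>_. fuzzy_borel p) X {1..}"
    and "\<forall>i\<ge>1. distr M (fuzzy_borel p) (X i) = distr M (fuzzy_borel p) (X 1)"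
    and "\<forall>i\<ge>1. has_bochner_expectation M (X i) m"
    and "\<forall>i\<ge>1. frechet_variance M (X i) = ennreal (\<sigma>\<^sup>2)"
    and "\<alpha> \<in> {0<..1}"
    and "u \<in> sphere 0 1"
    and "1 \<le> j"
    and "\<sigma>'\<^sup>2 = prob_space.variance M (\<lambda>\<omega>. supp_fun (X j \<omega>) \<alpha> u)"
    and "\<sigma>' > 0"
    and "standard_brownian_motion N b"
    and "\<forall>i. 0 \<le> t i"
    and "strict_mono t"
  shows "converges_in_distribution
           M (\<lambda>n \<omega>. \<chi> i. interpolated_supp_fun X m \<sigma>' \<alpha> u n (t i) \<omega>)
           N (\<lambda>\<omega>. \<chi> i. b (t i) \<omega>)"
proof -
  interpret M: prob_space M by fact
  have u: "norm u = 1" using assms(10) by simp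
  define h where "h x = supp_fun x \<alpha> u - supp_fun m \<alpha> u" for x :: "(real ^ 'd) fuzzy"
  define Y where "Y i \<omega> = h (X i \<omega>)" for i \<omega>
  have Xm: "X i \<in> measurable M (fuzzy_borel p)" if "1 \<le> i" for i
    using assms(4) that by blast
  have hm: "h \<in> borel_measurable (fuzzy_borel p)"
    unfolding h_def by (intro borel_measurable_diff borel_measurable_const supp_fun_measurable u assms)
  have Ym: "Y i \<in> borel_measurable M" if "1 \<le> i" for i
    unfolding Y_def by (rule measurable_compose[OF Xm[OF that] hm])
  have Y_indep: "M.indep_vars (\<lambda>_. borel) Y {1..}"
    unfolding Y_def by (rule M.indep_vars_compose2[OF assms(5)]) (rule hm)
  have Y_law: "distr M borel (Y i) = distr (distr M (fuzzy_borel p) (X 1)) borel h" if "1 \<le> i" for i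
  proof -
    have "distr M borel (Y i) = distr (distr M (fuzzy_borel p) (X i)) borel h"
      using Xm[OF that] hm by (subst distr_distr) (auto simp: comp_def Y_def[abs_def])
    also have "distr M (fuzzy_borel p) (X i) = distr M (fuzzy_borel p) (X 1)"
      using assms(6) that by blast
    finally show ?thesis .
  qed
  have B: "integrable M (\<lambda>\<omega>. supp_fun (X i \<omega>) \<alpha> u)"
    "supp_fun m \<alpha> u = (\<integral>\<omega>. supp_fun (X i \<omega>) \<alpha> u \<partial>M)" if "1 \<le> i" for i
    using assms(7,9,10) that unfolding has_bochner_expectation_def by blast+
  have Y_mean: "M.expectation (Y i) = 0" if "1 \<le> i" for i
    unfolding Y_def h_def using B[OF that] by (simp add: M.prob_space)
  have Yj: "M.expectation (\<lambda>\<omega>. (Y j \<omega>)\<^sup>2) = \<sigma>'\<^sup>2"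
    using assms(12) B(2)[OF assms(11)] by (simp add: Y_def h_def)
  have Yj_int: "integrable M (\<lambda>\<omega>. (Y j \<omega>)\<^sup>2)"
    \<comment> \<open>A non-integrable function has integral 0, whereas this second moment is positive.\<close>
    using Yj \<open>\<sigma>' > 0\<close> not_integrable_integral_eq by fastforce
  have law_j: "distr M borel (Y i) = distr M borel (Y j)" if "1 \<le> i" for i
    by (rule trans[OF Y_law[OF that] Y_law[OF assms(11), symmetric]])
  have Y_sq: "integrable M (\<lambda>\<omega>. (Y i \<omega>)\<^sup>2)" if "1 \<le> i" for i
  proof -
    have "integrable (distr M borel (Y j)) (\<lambda>y. y\<^sup>2)"
      using Yj_int Ym[OF assms(11)] by (simp add: integrable_distr_eq)
    then show ?thesis
      using Ym[OF that] unfolding law_j[OF that, symmetric] by (simp add: integrable_distr_eq)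
  qed
  have Y_var: "M.variance (Y i) = \<sigma>'\<^sup>2" if "1 \<le> i" for i
  proof -
    have "(\<integral>\<omega>. (Y i \<omega>)\<^sup>2 \<partial>M) = (\<integral>y. y\<^sup>2 \<partial>distr M borel (Y i))"
      using Ym[OF that] by (simp add: integral_distr)
    also have "\<dots> = (\<integral>\<omega>. (Y j \<omega>)\<^sup>2 \<partial>M)"
      unfolding law_j[OF that] using Ym[OF assms(11)] by (simp add: integral_distr)
    finally show ?thesis using Yj Y_mean[OF that] by simp
  qed
  have eq: "interpolated_supp_fun X m \<sigma>' \<alpha> u n r \<omega> = interpolated_walk Y \<sigma>' n r \<omega>"
    if \<omega>: "\<omega> \<in> space M" for n r \<omega>
  proof -
    have "X i \<omega> \<in> fcconv" if "1 \<le> i" for i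
      using measurable_space[OF Xm[OF that] \<omega>] by (simp add: space_fuzzy_borel)
    note S = supp_fun_fuzzy_partial_sum[where X = X and \<omega> = \<omega>, OF assms(9) this]
    have "(\<Sum>k\<in>{0<..q}. Y k \<omega>) = (\<Sum>k\<in>{0<..q}. supp_fun (X k \<omega>) \<alpha> u) - real q * supp_fun m \<alpha> u" for q
      by (simp add: Y_def h_def sum_subtractf)
    then show ?thesis
      by (simp add: interpolated_supp_fun_def interpolated_walk_def Let_def S Y_def h_def
          right_diff_distrib add_diff_eq diff_divide_distrib add_divide_distrib)
  qed
  have walk_m: "interpolated_walk Y \<sigma>' n r \<in> borel_measurable M" for n r
    unfolding interpolated_walk_def
    by (intro borel_measurable_divide borel_measurable_add borel_measurable_sum borel_measurable_times
        borel_measurable_const Ym) auto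
  have b_m: "b (t i) \<in> borel_measurable N" for i
    using assms(14,15) by (simp add: standard_brownian_motion_def)
  show ?thesis
    unfolding converges_in_distribution_def
  proof (intro conjI allI impI)
    show "(\<lambda>\<omega>. \<chi> i. b (t i) \<omega>) \<in> borel_measurable N" by (rule vec_lambda_measurable[OF b_m])
    fix n
    have "(\<lambda>\<omega>. \<chi> i. interpolated_walk Y \<sigma>' n (t i) \<omega>) \<in> borel_measurable M"
      by (rule vec_lambda_measurable[OF walk_m])
    then show "(\<lambda>\<omega>. \<chi> i. interpolated_supp_fun X m \<sigma>' \<alpha> u n (t i) \<omega>) \<in> borel_measurable M"
      by (rule measurable_cong[THEN iffD1, rotated]) (simp add: eq)
  next
    fix f :: "real ^ 'k::{finite,linorder} \<Rightarrow> real" assume f: "continuous_on UNIV f" "bounded (range f)"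
    have "(\<integral>\<omega>. f (\<chi> i. interpolated_supp_fun X m \<sigma>' \<alpha> u n (t i) \<omega>) \<partial>M)
        = (\<integral>\<omega>. f (\<chi> i. interpolated_walk Y \<sigma>' n (t i) \<omega>) \<partial>M)" for n
      by (rule Bochner_Integration.integral_cong) (simp_all add: eq)
    then show "(\<lambda>n. \<integral>\<omega>. f (\<chi> i. interpolated_supp_fun X m \<sigma>' \<alpha> u n (t i) \<omega>) \<partial>M)
        \<longlonglongrightarrow> (\<integral>\<omega>. f (\<chi> i. b (t i) \<omega>) \<partial>N)"
      using M.interpolated_walk_fdd_tendsto[OF Y_indep Y_law Y_mean Y_sq Y_var \<open>\<sigma>' > 0\<close> assms(14) _ f]
        assms(15) by simp
  qed
qed

end
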